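(* Let $M=\langle f_1,\dots,f_r\rangle\subseteq F$ be a graded submodule generated by homogeneous elements $f_1,\dots,f_r$, and set $M_0=\langle\tilde f_1,\dots,\tilde f_r\rangle\subseteq\tilde F$. Define a chain of bihomogeneous submodules of $\tilde F$ by the following procedure. Given $M_k=\langle g_1,\dots,g_{r_k}\rangle$ with $g_1,\dots,g_{r_k}$ bihomogeneous (for $k=0$ take $g_i=\tilde f_i$), choose a bihomogeneous exact sequence $$A^{s}\xrightarrow{\ \Phi\ }A^{r_k}\xrightarrow{(\underline{g_1},\dots,\underline{g_{r_k}})}F,$$ where $\Phi$ is a matrix with entries in $A$ and the second map sends the $i$-th basis element to $\underline{g_i}$. Viewing $\Phi$ as a map $\tilde A^s\to\tilde A^{r_k}$, one has $\bigl((g_1,\dots,g_{r_k})\circ\Phi\bigr)(\tilde A^s)=tQ$ for a bihomogeneous submodule $Q\subseteq\tilde F$. If $Q\subseteq M_k$, stop; otherwise set $M_{k+1}=M_k+Q$ and repeat. Then this procedure terminates after finitely many steps, and if $M_j$ is the last module of the chain then $M_j=\tilde M$. Consequently $(M_j)_{t=0}=\operatorname{in}_{(\omega,\epsilon)}(M)$.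
   Context: $K$ is a field, $A=K[X_1,\dots,X_n]$ is a polynomial ring, $\omega=(w_1,\dots,w_n)\in\mathbb Z_{\ge 0}^n$ is a weight, $F=\bigoplus_{j=1}^m A(-d_j)=\bigoplus_{j=1}^m Ae_j$ is a free graded $A$-module with basis $e_1,\dots,e_m$ of degrees $d_1,\dots,d_m$, and $\epsilon=(\epsilon_1,\dots,\epsilon_m)$ is a vector of non-negative integers. The weight of the monomial $\mathbf X^{\mathbf u}e_j\in F$ is $\omega\cdot\mathbf u+\epsilon_j$. For $0\ne f\in F$, $\operatorname{in}_{(\omega,\epsilon)}(f)$ is the sum of all terms of $f$ of largest weight, and $\operatorname{in}_{(\omega,\epsilon)}(M)$ is the submodule of $F$ generated by all $\operatorname{in}_{(\omega,\epsilon)}(f)$, $f\in M$. $\tilde A=A[t]$ is $\mathbb Z\times\mathbb Z$-graded with $\deg X_i=(1,w_i)$ and $\deg t=(0,1)$, and $\tilde F=\bigoplus_{j=1}^m\tilde Ae_j$ with $\deg e_j=(d_j,\epsilon_j)$; "bihomogeneous" refers to this bigrading, and $A$, $F$ are bigraded by the same degrees of $X_i$ and $e_j$. For $f=\sum c_{\mathbf u,j}\mathbf X^{\mathbf u}e_j\in F$ nonzero, its homogenization is $\tilde f=t^{d}\sum c_{\mathbf u,j}(t^{-\omega\cdot\mathbf u}\mathbf X^{\mathbf u})(t^{-\epsilon_j}e_j)\in\tilde F$, where $d$ is the largest weight of a monomial in the support of $f$. For a submodule $M\subseteq F$, $\tilde M\subseteq\tilde F$ is the submodule generated by all $\tilde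 f$, $f\in M$. For $q\in\tilde F$, $\underline q\in F$ is its image under evaluating $t$ at $0$; for a submodule $N\subseteq\tilde F$, $N_{t=0}$ is the image of $N$ in $F$ under this evaluation. *)

theory Defs
  imports
    "HOL-Analysis.Finite_Cartesian_Product"
    "HOL-Library.Poly_Mapping"
    "HOL-Computational_Algebra.Polynomial"
begin

text \<open>
  The polynomial ring \<open>A = K[X\<^sub>i | i \<in> 'n]\<close> is \<open>('n, 'k) mpoly\<close>, the ring \<open>A[t]\<close> is
  \<open>('n, 'k) mpoly poly\<close>, and the free modules \<open>F\<close> and \<open>F~\<close> of rank \<open>CARD('m)\<close> are
  \<open>('n, 'k) mpoly ^ 'm\<close> and \<open>('n, 'k) mpoly poly ^ 'm\<close>. The coefficient of \<open>X\<^sup>u e\<^sub>j\<close> in \<open>f\<close>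
  is \<open>lookup (f $ j) u\<close>.
\<close>

type_synonym ('n, 'k) mpoly = "('n \<Rightarrow>\<^sub>0 nat) \<Rightarrow>\<^sub>0 'k"

lemma module_vector_scalar_mult:
  "module ((*s) :: 'a::comm_ring_1 \<Rightarrow> 'a ^ 'm \<Rightarrow> 'a ^ 'm)"
  by unfold_locales (simp_all add: vec_eq_iff algebra_simps)

abbreviation submodule_span :: "('a::comm_ring_1 ^ 'm) set \<Rightarrow> ('a ^ 'm) set"
  where "submodule_span \<equiv> module.span (*s)"

definition tdeg :: "('n::finite \<Rightarrow>\<^sub>0 nat) \<Rightarrow> nat"
  where "tdeg u = (\<Sum>i\<in>UNIV. Poly_Mapping.lookup u i)"

definition wdeg :: "('n::finite \<Rightarrow> nat) \<Rightarrow> ('n \<Rightarrow>\<^sub>0 nat) \<Rightarrow> nat"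
  where "wdeg w u = (\<Sum>i\<in>UNIV. w i * Poly_Mapping.lookup u i)"

definition monomials :: "('n, 'k::zero) mpoly ^ 'm \<Rightarrow> (('n \<Rightarrow>\<^sub>0 nat) \<times> 'm) set"
  where "monomials f = {(u, j). u \<in> Poly_Mapping.keys (f $ j)}"

definition max_weight ::
    "('n::finite \<Rightarrow> nat) \<Rightarrow> ('m \<Rightarrow> nat) \<Rightarrow> ('n, 'k::zero) mpoly ^ 'm \<Rightarrow> nat"
  where "max_weight w \<epsilon> f = Max ((\<lambda>(u, j). wdeg w u + \<epsilon> j) ` monomials f)"

definition initial_form ::
    "('n::finite \<Rightarrow> nat) \<Rightarrow> ('m::finite \<Rightarrow> nat) \<Rightarrow> ('n, 'k::field) mpoly ^ 'm \<Rightarrow> ('n, 'k) mpoly ^ 'm"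
  where "initial_form w \<epsilon> f =
    (\<chi> j. \<Sum>u | u \<in> Poly_Mapping.keys (f $ j) \<and> wdeg w u + \<epsilon> j = max_weight w \<epsilon> f.
             Poly_Mapping.single u (Poly_Mapping.lookup (f $ j) u))"

definition initial_module ::
    "('n::finite \<Rightarrow> nat) \<Rightarrow> ('m::finite \<Rightarrow> nat) \<Rightarrow> (('n, 'k::field) mpoly ^ 'm) set \<Rightarrow>
     (('n, 'k) mpoly ^ 'm) set"
  where "initial_module w \<epsilon> M = submodule_span {initial_form w \<epsilon> f | f. f \<in> M \<and> f \<noteq> 0}"

text \<open>
  The subtraction on the naturals below is never truncated, as \<open>max_weight\<close> bounds the weights of
  all monomials of \<open>f\<close>. In particular, \<open>0\<close> is homogenized to \<open>0\<close>.
\<close>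

definition homogenization ::
    "('n::finite \<Rightarrow> nat) \<Rightarrow> ('m::finite \<Rightarrow> nat) \<Rightarrow> ('n, 'k::field) mpoly ^ 'm \<Rightarrow>
     ('n, 'k) mpoly poly ^ 'm"
  where "homogenization w \<epsilon> f =
    (\<chi> j. \<Sum>u\<in>Poly_Mapping.keys (f $ j).
             monom (Poly_Mapping.single u (Poly_Mapping.lookup (f $ j) u))
               (max_weight w \<epsilon> f - (wdeg w u + \<epsilon> j)))"

definition homogenized_module ::
    "('n::finite \<Rightarrow> nat) \<Rightarrow> ('m::finite \<Rightarrow> nat) \<Rightarrow> (('n, 'k::field) mpoly ^ 'm) set \<Rightarrow>
     (('n, 'k) mpoly poly ^ 'm) set"
  where "homogenized_module w \<epsilon> M = submodule_span {homogenization w \<epsilon> f | f. f \<in> M \<and> f \<noteq> 0}"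

definition eval_t0 :: "('n, 'k::field) mpoly poly ^ 'm::finite \<Rightarrow> ('n, 'k) mpoly ^ 'm"
  where "eval_t0 q = (\<chi> j. poly (q $ j) 0)"

definition homogeneous :: "('m \<Rightarrow> int) \<Rightarrow> ('n::finite, 'k::zero) mpoly ^ 'm \<Rightarrow> bool"
  where "homogeneous d f \<longleftrightarrow> (\<exists>a. \<forall>(u, j)\<in>monomials f. int (tdeg u) + d j = a)"

definition bihomogeneous_poly ::
    "('n::finite \<Rightarrow> nat) \<Rightarrow> int \<times> int \<Rightarrow> ('n, 'k::zero) mpoly \<Rightarrow> bool"
  where "bihomogeneous_poly w b p \<longleftrightarrow> (\<forall>u\<in>Poly_Mapping.keys p. (int (tdeg u), int (wdeg w u)) = b)"

definition bihomogeneous_of ::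
    "('n::finite \<Rightarrow> nat) \<Rightarrow> ('m \<Rightarrow> int) \<Rightarrow> ('m \<Rightarrow> nat) \<Rightarrow> int \<times> int \<Rightarrow>
     ('n, 'k::zero) mpoly poly ^ 'm \<Rightarrow> bool"
  where "bihomogeneous_of w d \<epsilon> b q \<longleftrightarrow>
    (\<forall>j k. \<forall>u\<in>Poly_Mapping.keys (coeff (q $ j) k).
       (int (tdeg u) + d j, int (wdeg w u + k + \<epsilon> j)) = b)"

definition bihomogeneous ::
    "('n::finite \<Rightarrow> nat) \<Rightarrow> ('m \<Rightarrow> int) \<Rightarrow> ('m \<Rightarrow> nat) \<Rightarrow> ('n, 'k::zero) mpoly poly ^ 'm \<Rightarrow> bool"
  where "bihomogeneous w d \<epsilon> q \<longleftrightarrow> (\<exists>b. bihomogeneous_of w d \<epsilon> b q)"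

definition bihomogeneous_submodule ::
    "('n::finite \<Rightarrow> nat) \<Rightarrow> ('m::finite \<Rightarrow> int) \<Rightarrow> ('m \<Rightarrow> nat) \<Rightarrow>
     (('n, 'k::field) mpoly poly ^ 'm) set \<Rightarrow> bool"
  where "bihomogeneous_submodule w d \<epsilon> N \<longleftrightarrow>
    (\<exists>B. (\<forall>q\<in>B. bihomogeneous w d \<epsilon> q) \<and> N = submodule_span B)"

text \<open>
  The ranks \<open>r\<close> and \<open>s\<close> vary along the procedure, so elements of \<open>A\<^sup>r\<close> are functions on \<open>nat\<close> of
  which only the values at \<open>i < r\<close> matter, and a matrix \<open>\<Phi>\<close> with \<open>r\<close> rows and \<open>s\<close> columns has the
  entries \<open>\<Phi> i l\<close> with \<open>i < r\<close> and \<open>l < s\<close>.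

  In a bihomogeneous sequence the \<open>i\<close>-th basis element of \<open>A\<^sup>r\<close> has the bidegree \<open>b i\<close> of \<open>g\<^sub>i\<close>
  (also when \<open>g\<^sub>i\<close> vanishes at \<open>t = 0\<close>), and the \<open>l\<close>-th basis element of \<open>A\<^sup>s\<close> has some bidegree
  \<open>c l\<close>; both maps preserve bidegrees.
\<close>

definition exact_sequence ::
    "(('n, 'k::field) mpoly poly ^ 'm::finite) list \<Rightarrow> nat \<Rightarrow> (nat \<Rightarrow> nat \<Rightarrow> ('n, 'k) mpoly) \<Rightarrow> bool"
  where "exact_sequence gs s \<Phi> \<longleftrightarrow>
    (\<forall>v :: nat \<Rightarrow> ('n, 'k) mpoly.
       (\<Sum>i<length gs. v i *s eval_t0 (gs ! i)) = 0 \<longleftrightarrow>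
       (\<exists>x :: nat \<Rightarrow> ('n, 'k) mpoly. \<forall>i<length gs. v i = (\<Sum>l<s. \<Phi> i l * x l)))"

definition bihomogeneous_exact_sequence ::
    "('n::finite \<Rightarrow> nat) \<Rightarrow> ('m::finite \<Rightarrow> int) \<Rightarrow> ('m \<Rightarrow> nat) \<Rightarrow>
     (('n, 'k::field) mpoly poly ^ 'm) list \<Rightarrow> nat \<Rightarrow> (nat \<Rightarrow> nat \<Rightarrow> ('n, 'k) mpoly) \<Rightarrow> bool"
  where "bihomogeneous_exact_sequence w d \<epsilon> gs s \<Phi> \<longleftrightarrow>
    exact_sequence gs s \<Phi> \<and>
    (\<exists>b c. (\<forall>i<length gs. bihomogeneous_of w d \<epsilon> (b i) (gs ! i)) \<and>
       (\<forall>i<length gs. \<forall>l<s.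
          bihomogeneous_poly w (fst (c l) - fst (b i), snd (c l) - snd (b i)) (\<Phi> i l)))"

definition syzygy_image ::
    "(('n, 'k::field) mpoly poly ^ 'm::finite) list \<Rightarrow> nat \<Rightarrow> (nat \<Rightarrow> nat \<Rightarrow> ('n, 'k) mpoly) \<Rightarrow>
     (('n, 'k) mpoly poly ^ 'm) set"
  where "syzygy_image gs s \<Phi> =
    {(\<Sum>i<length gs. (\<Sum>l<s. [:\<Phi> i l:] * y l) *s (gs ! i)) | y :: nat \<Rightarrow> ('n, 'k) mpoly poly. True}"

definition t_times :: "('n, 'k::field) mpoly poly ^ 'm::finite \<Rightarrow> ('n, 'k) mpoly poly ^ 'm"
  where "t_times q = [:0, 1:] *s q"

definition round_quotient ::
    "('n::finite \<Rightarrow> nat) \<Rightarrow> ('m::finite \<Rightarrow> int) \<Rightarrow> ('m \<Rightarrow> nat) \<Rightarrow>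
     (('n, 'k::field) mpoly poly ^ 'm) list \<Rightarrow> nat \<Rightarrow> (nat \<Rightarrow> nat \<Rightarrow> ('n, 'k) mpoly) \<Rightarrow>
     (('n, 'k) mpoly poly ^ 'm) set \<Rightarrow> bool"
  where "round_quotient w d \<epsilon> gs s \<Phi> Q \<longleftrightarrow>
    bihomogeneous_submodule w d \<epsilon> Q \<and> syzygy_image gs s \<Phi> = t_times ` Q"

text \<open>
  \<open>enlarged_gens\<close> says that \<open>gs'\<close> is a bihomogeneous generating list of \<open>\<langle>gs\<rangle> + Q\<close>. The procedure
  fixes no particular generators of the next module, so every such list is an admissible choice.
\<close>

definition enlarged_gens ::
    "('n::finite \<Rightarrow> nat) \<Rightarrow> ('m::finite \<Rightarrow> int) \<Rightarrow> ('m \<Rightarrow> nat) \<Rightarrow>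
     (('n, 'k::field) mpoly poly ^ 'm) list \<Rightarrow> (('n, 'k) mpoly poly ^ 'm) set \<Rightarrow>
     (('n, 'k) mpoly poly ^ 'm) list \<Rightarrow> bool"
  where "enlarged_gens w d \<epsilon> gs Q gs' \<longleftrightarrow>
    (\<forall>g\<in>set gs'. bihomogeneous w d \<epsilon> g) \<and>
    submodule_span (set gs') = {x + y | x y. x \<in> submodule_span (set gs) \<and> y \<in> Q}"

definition continues ::
    "('n::finite \<Rightarrow> nat) \<Rightarrow> ('m::finite \<Rightarrow> int) \<Rightarrow> ('m \<Rightarrow> nat) \<Rightarrow>
     (('n, 'k::field) mpoly poly ^ 'm) list \<Rightarrow> (('n, 'k) mpoly poly ^ 'm) list \<Rightarrow> bool"
  where "continues w d \<epsilon> gs gs' \<longleftrightarrow>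
    (\<exists>s \<Phi> Q. bihomogeneous_exact_sequence w d \<epsilon> gs s \<Phi> \<and> round_quotient w d \<epsilon> gs s \<Phi> Q \<and>
       \<not> Q \<subseteq> submodule_span (set gs) \<and> enlarged_gens w d \<epsilon> gs Q gs')"

definition stops ::
    "('n::finite \<Rightarrow> nat) \<Rightarrow> ('m::finite \<Rightarrow> int) \<Rightarrow> ('m \<Rightarrow> nat) \<Rightarrow>
     (('n, 'k::field) mpoly poly ^ 'm) list \<Rightarrow> bool"
  where "stops w d \<epsilon> gs \<longleftrightarrow>
    (\<exists>s \<Phi> Q. bihomogeneous_exact_sequence w d \<epsilon> gs s \<Phi> \<and> round_quotient w d \<epsilon> gs s \<Phi> Q \<and>
       Q \<subseteq> submodule_span (set gs))"

end

theory Submission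
  imports Defs
begin

text \<open>
  Setting \<open>t = 1\<close> loses almost nothing on elements of \<open>F~\<close> that are homogeneous for the weight: such
  a \<open>q\<close> is a power of \<open>t\<close> times the homogenization of \<open>q(1)\<close>
  (\<open>weight_homogeneous_eq_homogenization\<close>), because the exponent of \<open>t\<close> at \<open>X\<^sup>u e\<^sub>j\<close> is determined by
  \<open>u\<close>, \<open>j\<close> and the weight of \<open>q\<close>. Hence \<open>M~\<close> contains every weight-homogeneous \<open>q\<close> with
  \<open>q(1) \<in> M\<close>, and every element of \<open>M~\<close> specializes into \<open>M\<close> at \<open>t = 1\<close>. The theorem follows from
  this correspondence, saturation with respect to \<open>t\<close>, and Noetherianity.

  \<^item> The chain stays inside \<open>M~\<close>: if \<open>q\<close> is a bihomogeneous generator of \<open>Q\<close>, then \<open>t q\<close> lies in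
    the current module, so \<open>q(1) = (t q)(1)\<close> lies in \<open>M\<close> and \<open>q\<close> lies in \<open>M~\<close>
    (\<open>round_quotient_subset_homogenized_module\<close>).

  \<^item> A module \<open>N\<close> at which the procedure stops is \<open>t\<close>-saturated. If \<open>t q = \<Sum> a\<^sub>i g\<^sub>i\<close>, the constant
    terms \<open>a\<^sub>i(0)\<close> form a syzygy of the \<open>g\<^sub>i(0)\<close>, so \<open>\<Sum> a\<^sub>i(0) g\<^sub>i\<close> lies in \<open>t Q \<subseteq> t N\<close>; what
    remains is visibly in \<open>t N\<close> (\<open>stops_t_saturated\<close>).

  \<^item> Every \<open>f \<in> M\<close> is the value at \<open>t = 1\<close> of some weight-homogeneous element of the module
    generated by the homogenized generators (\<open>weight_homogeneous_lift\<close>). That element is a power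
    of \<open>t\<close> times the homogenization of \<open>f\<close>, so saturation puts all of \<open>M~\<close> into \<open>N\<close>.

  \<^item> Each round that does not stop enlarges the module strictly, which cannot go on forever over
    the Noetherian ring \<open>A[t]\<close>.

  \<^item> A round can always be carried out: the syzygies of the \<open>g\<^sub>i(0)\<close> form a finitely generated module
    over \<open>A\<close>, and the bihomogeneous components of a syzygy are again syzygies
    (\<open>component_syzygy\<close>), so finitely many bihomogeneous columns suffice for \<open>\<Phi>\<close>. The combinations
    of the \<open>g\<^sub>i\<close> given by the columns vanish at \<open>t = 0\<close>; dividing them by \<open>t\<close> gives generators of \<open>Q\<close>.

  The initial module is the image of \<open>M~\<close> at \<open>t = 0\<close>, since the homogenization of \<open>f\<close> specializes
  there to the initial form of \<open>f\<close>.
\<close>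

interpretation vmod: module "(*s) :: 'a::comm_ring_1 \<Rightarrow> 'a ^ 'm \<Rightarrow> 'a ^ 'm"
  by (rule module_vector_scalar_mult)

section \<open>The Hilbert basis theorem for subrings\<close>

text \<open>
  The variables of \<open>A\<close> are indexed by a finite type, so they cannot be adjoined one at a time by
  iterating the type constructor of polynomials. They are adjoined inside the fixed ring \<open>A[t]\<close>,
  which is why Noetherianity is formulated for subrings of a ring.
\<close>

definition subring :: "'a::comm_ring_1 set \<Rightarrow> bool"
  where "subring R \<longleftrightarrow> 1 \<in> R \<and> (\<forall>a\<in>R. \<forall>b\<in>R. a - b \<in> R \<and> a * b \<in> R)"

lemma subring_zero: "subring R \<Longrightarrow> 0 \<in> R"
  unfolding subring_def by (metis diff_self)

lemma subring_uminus: "subring R \<Longrightarrow> a \<in> R \<Longrightarrow> - a \<in> R"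
  using subring_zero unfolding subring_def by (metis diff_0)

lemma subring_add: "subring R \<Longrightarrow> a \<in> R \<Longrightarrow> b \<in> R \<Longrightarrow> a + b \<in> R"
  using subring_uminus[of R b] unfolding subring_def by (metis diff_minus_eq_add)

lemma subring_mult: "subring R \<Longrightarrow> a \<in> R \<Longrightarrow> b \<in> R \<Longrightarrow> a * b \<in> R"
  unfolding subring_def by blast

lemma subring_sum: "subring R \<Longrightarrow> (\<And>i. i \<in> I \<Longrightarrow> f i \<in> R) \<Longrightarrow> sum f I \<in> R"
  by (induction I rule: infinite_finite_induct) (auto intro: subring_zero subring_add)

lemma subring_power: "subring R \<Longrightarrow> a \<in> R \<Longrightarrow> a ^ n \<in> R"
  by (induction n) (auto simp: subring_def)

text \<open>
  The \<open>R\<close>-submodule generated by \<open>B\<close>. For \<open>B \<subseteq> R\<close> it is the ideal of \<open>R\<close> generated by \<open>B\<close>; for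
  \<open>R = UNIV\<close> it is an ideal of the whole ring.
\<close>

inductive_set rspan :: "'a::comm_ring_1 set \<Rightarrow> 'a set \<Rightarrow> 'a set" for R B where
  zero: "0 \<in> rspan R B"
| step: "r \<in> R \<Longrightarrow> b \<in> B \<Longrightarrow> x \<in> rspan R B \<Longrightarrow> r * b + x \<in> rspan R B"

lemma rspan_add: "x \<in> rspan R B \<Longrightarrow> y \<in> rspan R B \<Longrightarrow> x + y \<in> rspan R B"
  by (induction rule: rspan.induct) (auto simp: add.assoc intro: rspan.step)

lemma rspan_scale:
  assumes "subring R" "r \<in> R" "x \<in> rspan R B"
  shows "r * x \<in> rspan R B"
  using assms(3)
proof induction
  case (step s b x)
  then have "(r * s) * b + r * x \<in> rspan R B"
    using assms by (auto intro: rspan.step subring_mult)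
  then show ?case by (simp add: algebra_simps)
qed (simp add: rspan.zero)

lemma rspan_base: "subring R \<Longrightarrow> b \<in> B \<Longrightarrow> b \<in> rspan R B"
  using rspan.step[of 1 R b B 0] rspan.zero unfolding subring_def by auto

lemma rspan_diff:
  assumes "subring R" "x \<in> rspan R B" "y \<in> rspan R B"
  shows "x - y \<in> rspan R B"
proof -
  have "- 1 \<in> R"
    using assms(1) subring_uminus unfolding subring_def by blast
  then have "x + (- 1) * y \<in> rspan R B"
    by (intro rspan_add rspan_scale assms)
  then show ?thesis by simp
qed

lemma rspan_subset:
  assumes "subring R" "B \<subseteq> rspan R C"
  shows "rspan R B \<subseteq> rspan R C"
proof
  fix x assume "x \<in> rspan R B"
  then show "x \<in> rspan R C"
    using assms by induction (auto intro!: rspan.zero rspan_add rspan_scale)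
qed

lemma rspan_mono:
  assumes "B \<subseteq> C" shows "rspan R B \<subseteq> rspan R C"
proof
  fix x assume "x \<in> rspan R B"
  then show "x \<in> rspan R C"
    using assms by induction (auto intro: rspan.intros)
qed

lemma rspan_range_finite:
  assumes "finite F" "F \<subseteq> rspan R (range p)"
  shows "\<exists>n::nat. F \<subseteq> rspan R (p ` {..<n})"
proof -
  have single: "\<exists>n. x \<in> rspan R (p ` {..<n})" if "x \<in> rspan R (range p)" for x
    using that
  proof induction
    case zero
    then show ?case by (auto intro: rspan.zero)
  next
    case (step r b x)
    then obtain n m where "x \<in> rspan R (p ` {..<n})" "b = p m" by auto
    moreover have "rspan R (p ` {..<n}) \<subseteq> rspan R (p ` {..<max n (Suc m)})"
      by (intro rspan_mono) auto
    ultimately have "r * b + x \<in> rspan R (p ` {..<max n (Suc m)})"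
      using step by (intro rspan.step) auto
    then show ?case by blast
  qed
  show ?thesis
    using assms
  proof (induction F)
    case empty
    then show ?case by auto
  next
    case (insert x F)
    then obtain n m where "F \<subseteq> rspan R (p ` {..<n})" "x \<in> rspan R (p ` {..<m})"
      using single[of x] by auto
    moreover have "rspan R (p ` {..<k}) \<subseteq> rspan R (p ` {..<max n m})" if "k = n \<or> k = m" for k
      using that by (intro rspan_mono) auto
    ultimately have "insert x F \<subseteq> rspan R (p ` {..<max n m})" by blast
    then show ?case by blast
  qed
qed

text \<open>
  The ascending chain condition for the ideals generated by initial segments of a sequence. Leading
  coefficients of a sequence of polynomials can be fed into it directly.
\<close>

definition noetherian :: "'a::comm_ring_1 set \<Rightarrow> bool"
  where "noetherian R \<longleftrightarrow>
    (\<forall>a :: nat \<Rightarrow> 'a. range a \<subseteq> R \<longrightarrow> (\<exists>n. a n \<in> rspan R (a ` {..<n})))"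

lemma noetherian_field:
  assumes "\<And>x. x \<in> R \<Longrightarrow> x \<noteq> 0 \<Longrightarrow> \<exists>y\<in>R. y * x = 1" "subring R"
  shows "noetherian R"
  unfolding noetherian_def
proof (intro allI impI)
  fix a :: "nat \<Rightarrow> 'a" assume a: "range a \<subseteq> R"
  show "\<exists>n. a n \<in> rspan R (a ` {..<n})"
  proof (cases "a 0 = 0")
    case True
    then show ?thesis by (metis rspan.zero)
  next
    case False
    then obtain y where y: "y \<in> R" "y * a 0 = 1" using assms(1) a by blast
    have "(a 1 * y) * a 0 + 0 \<in> rspan R (a ` {..<1})"
      using y a by (intro rspan.intros subring_mult assms) auto
    then show ?thesis using y by (metis mult.assoc mult.right_neutral add.right_neutral)
  qed
qed

definition coeffs_in :: "'a::comm_ring_1 set \<Rightarrow> 'a poly \<Rightarrow> bool"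
  where "coeffs_in R p \<longleftrightarrow> (\<forall>i. coeff p i \<in> R)"

definition adjoin :: "'a::comm_ring_1 set \<Rightarrow> 'a \<Rightarrow> 'a set"
  where "adjoin R y = {poly p y | p. coeffs_in R p}"

lemma coeffs_in_mult: "subring R \<Longrightarrow> coeffs_in R p \<Longrightarrow> coeffs_in R q \<Longrightarrow> coeffs_in R (p * q)"
  unfolding coeffs_in_def coeff_mult by (auto intro!: subring_sum subring_mult)

lemma coeffs_in_diff: "subring R \<Longrightarrow> coeffs_in R p \<Longrightarrow> coeffs_in R q \<Longrightarrow> coeffs_in R (p - q)"
  unfolding coeffs_in_def subring_def by auto

lemma coeffs_in_add: "subring R \<Longrightarrow> coeffs_in R p \<Longrightarrow> coeffs_in R q \<Longrightarrow> coeffs_in R (p + q)"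
  unfolding coeffs_in_def by (auto intro: subring_add)

lemma coeffs_in_monom: "subring R \<Longrightarrow> a \<in> R \<Longrightarrow> coeffs_in R (monom a n)"
  unfolding coeffs_in_def by (auto intro: subring_zero)

lemma subring_adjoin: "subring R \<Longrightarrow> subring (adjoin R y)"
  unfolding subring_def[of "adjoin R y"]
proof (intro conjI ballI)
  assume R: "subring R"
  have "coeffs_in R (monom 1 0)"
    using R by (intro coeffs_in_monom) (auto simp: subring_def)
  moreover have "1 = poly (monom 1 0) y" by (simp add: poly_monom)
  ultimately show "1 \<in> adjoin R y" unfolding adjoin_def by blast
  fix a b assume "a \<in> adjoin R y" "b \<in> adjoin R y"
  then obtain p q where "a = poly p y" "b = poly q y" "coeffs_in R p" "coeffs_in R q"
    unfolding adjoin_def by blast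
  then have "a - b = poly (p - q) y" "a * b = poly (p * q) y"
    "coeffs_in R (p - q)" "coeffs_in R (p * q)"
    using R by (auto intro: coeffs_in_diff coeffs_in_mult)
  then show "a - b \<in> adjoin R y" "a * b \<in> adjoin R y"
    unfolding adjoin_def by blast+
qed

lemma adjoin_extends: "subring R \<Longrightarrow> R \<subseteq> adjoin R y"
proof
  fix a assume "subring R" "a \<in> R"
  then have "coeffs_in R (monom a 0)" "a = poly (monom a 0) y"
    by (auto intro: coeffs_in_monom simp: poly_monom)
  then show "a \<in> adjoin R y" unfolding adjoin_def by blast
qed

lemma adjoin_generator: "subring R \<Longrightarrow> y \<in> adjoin R y"
proof -
  assume "subring R"
  then have "coeffs_in R (monom 1 1)" "y = poly (monom 1 1) y"
    by (auto intro!: coeffs_in_monom simp: poly_monom subring_def)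
  then show "y \<in> adjoin R y" unfolding adjoin_def by blast
qed

text \<open>
  Hilbert's argument. From a sequence violating the condition, choose polynomials \<open>f\<^sub>0, f\<^sub>1, \<dots>\<close> over
  \<open>R\<close>, each of minimal degree among those whose value at \<open>y\<close> lies in the ideal generated by the sequence but outside the
  ideal generated by the values of the earlier ones. Some leading coefficient is a combination of
  earlier ones, which allows the degree of that \<open>f\<^sub>n\<close> to be lowered, contradicting minimality.
  Since only values at \<open>y\<close> are compared, \<open>y\<close> may be algebraic over \<open>R\<close>.
\<close>

lemma noetherian_adjoin:
  fixes y :: "'a::comm_ring_1"
  assumes R: "subring R" and noeth: "noetherian R"
  shows "noetherian (adjoin R y)"
proof (rule ccontr)
  define R' where "R' = adjoin R y"
  have R': "subring R'" unfolding R'_def by (rule subring_adjoin[OF R])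
  assume "\<not> noetherian (adjoin R y)"
  then obtain p where p: "range p \<subseteq> R'" and bad: "\<And>n. p n \<notin> rspan R' (p ` {..<n::nat})"
    unfolding noetherian_def R'_def by blast
  define I where "I = rspan R' (range p)"
  define cand where "cand k f r \<longleftrightarrow>
    coeffs_in R r \<and> poly r y \<in> I \<and> poly r y \<notin> rspan R' ((\<lambda>i. poly (f i) y) ` {..<k})"
    for k :: nat and f :: "nat \<Rightarrow> 'a poly" and r
  define P where "P k f r \<longleftrightarrow> cand k f r \<and> (\<forall>r'. cand k f r' \<longrightarrow> degree r \<le> degree r')" for k f r
  have "\<exists>f. \<forall>k. P k f (f k)"
  proof (rule dependent_wellorder_choice)
    fix r :: "'a poly" and f g :: "nat \<Rightarrow> 'a poly" and k :: nat
    assume "\<And>i. i < k \<Longrightarrow> f i = g i"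
    then have "(\<lambda>i. poly (f i) y) ` {..<k} = (\<lambda>i. poly (g i) y) ` {..<k}"
      by (intro image_cong) auto
    then show "P k f r = P k g r" unfolding P_def cand_def by simp
  next
    fix k :: nat and f :: "nat \<Rightarrow> 'a poly"
    assume prev: "\<And>i. i < k \<Longrightarrow> P i f (f i)"
    let ?F = "(\<lambda>i. poly (f i) y) ` {..<k}"
    have "?F \<subseteq> I" using prev unfolding P_def cand_def by auto
    then obtain n where n: "?F \<subseteq> rspan R' (p ` {..<n})"
      using rspan_range_finite[of ?F R' p] unfolding I_def by auto
    then have "p n \<notin> rspan R' ?F"
      using bad rspan_subset[OF R' n] by blast
    moreover have "p n \<in> I" unfolding I_def by (rule rspan_base[OF R']) auto
    moreover obtain q where "coeffs_in R q" "p n = poly q y"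
      using p unfolding R'_def adjoin_def by blast
    ultimately have "cand k f q" unfolding cand_def by auto
    then show "\<exists>r. P k f r"
      using ex_has_least_nat[of "cand k f" q degree] unfolding P_def by blast
  qed
  then obtain f where f: "\<And>k. P k f (f k)" by blast
  have cand: "cand k f (f k)" for k
    using f unfolding P_def by blast
  have least: "degree (f k) \<le> degree r" if "cand k f r" for k r
    using f that unfolding P_def by blast
  let ?a = "\<lambda>k. lead_coeff (f k)"
  have "range ?a \<subseteq> R" using cand unfolding cand_def coeffs_in_def by auto
  then obtain n where n: "?a n \<in> rspan R (?a ` {..<n})"
    using noeth unfolding noetherian_def by blast
  let ?D = "degree (f n)"
  let ?V = "rspan R' ((\<lambda>i. poly (f i) y) ` {..<n})"
  have degree_mono: "degree (f i) \<le> ?D" if "i < n" for i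
  proof (rule least)
    have "rspan R' ((\<lambda>i. poly (f i) y) ` {..<i}) \<subseteq> ?V"
      using that by (intro rspan_mono) auto
    then show "cand i f (f n)" using cand[of n] unfolding cand_def by blast
  qed
  \<comment> \<open>a relation among leading coefficients lifts to polynomials shifted to degree \<open>?D\<close>\<close>
  have "\<exists>h. coeffs_in R h \<and> degree h \<le> ?D \<and> coeff h ?D = x \<and> poly h y \<in> ?V"
    if "x \<in> rspan R (?a ` {..<n})" for x
    using that
  proof induction
    case zero
    have "coeffs_in R 0" using R unfolding coeffs_in_def by (auto intro: subring_zero)
    then show ?case using rspan.zero by (intro exI[of _ 0]) auto
  next
    case (step r b x)
    then obtain h i where h: "coeffs_in R h" "degree h \<le> ?D" "coeff h ?D = x" "poly h y \<in> ?V"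
      and i: "i < n" "b = ?a i" by auto
    let ?m = "monom r (?D - degree (f i))"
    let ?h = "?m * f i + h"
    have m: "coeffs_in R ?m" using step by (intro coeffs_in_monom R) auto
    have "coeffs_in R ?h"
      using m h cand[of i] unfolding cand_def by (intro coeffs_in_add coeffs_in_mult R) auto
    moreover have "degree ?h \<le> ?D"
    proof (rule degree_add_le)
      have "degree (?m * f i) \<le> (?D - degree (f i)) + degree (f i)"
        by (rule order_trans[OF degree_mult_le]) (auto intro: degree_monom_le)
      then show "degree (?m * f i) \<le> ?D" using degree_mono[OF i(1)] by simp
    qed (rule h)
    moreover have "coeff ?h ?D = r * b + x"
      using degree_mono[OF i(1)] h i by (simp add: coeff_monom_mult)
    moreover have "poly ?h y \<in> ?V"
    proof -
      have "poly ?m y \<in> R'" using m unfolding R'_def adjoin_def by blast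
      then have "poly ?m y * poly (f i) y + poly h y \<in> ?V"
        using i h by (intro rspan.step) auto
      then show ?thesis by simp
    qed
    ultimately show ?case by blast
  qed
  from this[OF n] obtain h where h: "coeffs_in R h" "degree h \<le> ?D" "coeff h ?D = ?a n" "poly h y \<in> ?V"
    by blast
  have "?V \<subseteq> I"
    using cand unfolding I_def by (intro rspan_subset[OF R']) (auto simp: cand_def I_def)
  let ?g = "f n - h"
  have "cand n f ?g"
    unfolding cand_def
  proof (intro conjI)
    show "coeffs_in R ?g" using cand[of n] h R by (auto simp: cand_def intro: coeffs_in_diff)
    show "poly ?g y \<in> I"
      using cand[of n] h \<open>?V \<subseteq> I\<close> R' by (auto simp: cand_def I_def intro!: rspan_diff)
    show "poly ?g y \<notin> ?V"
    proof
      assume "poly ?g y \<in> ?V"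
      then have "poly ?g y + poly h y \<in> ?V" using h by (intro rspan_add)
      then show False using cand[of n] unfolding cand_def by simp
    qed
  qed
  then have "?D \<le> degree ?g" by (rule least)
  moreover have "degree ?g \<le> ?D" using h by (intro degree_diff_le) auto
  ultimately have "degree ?g = ?D" by (rule antisym[rotated])
  moreover have "coeff ?g ?D = 0" using h by simp
  ultimately have "?g = 0" by (metis leading_coeff_0_iff)
  then show False
    using \<open>cand n f ?g\<close> rspan.zero unfolding cand_def by auto
qed

lemma noetherian_finite_extension:
  assumes "finite Y" "subring R" "noetherian R"
  shows "\<exists>S. subring S \<and> noetherian S \<and> R \<subseteq> S \<and> Y \<subseteq> S"
  using assms
proof (induction Y)
  case empty
  then show ?case by blast
next
  case (insert y Y)
  then obtain S where S: "subring S" "noetherian S" "R \<subseteq> S" "Y \<subseteq> S" by blast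
  then have "subring (adjoin S y)" "noetherian (adjoin S y)" "R \<subseteq> adjoin S y" "insert y Y \<subseteq> adjoin S y"
    using subring_adjoin noetherian_adjoin adjoin_extends[of S y] adjoin_generator by auto
  then show ?case by blast
qed

lemma monomial_as_sum:
  fixes u :: "'n::finite \<Rightarrow>\<^sub>0 nat"
  shows "u = (\<Sum>i\<in>UNIV. Poly_Mapping.single i (Poly_Mapping.lookup u i))"
  by (rule poly_mapping_eqI) (simp add: lookup_sum lookup_single when_def)

lemma mpoly_as_sum:
  fixes p :: "('n, 'k::comm_ring_1) mpoly"
  shows "p = (\<Sum>u\<in>Poly_Mapping.keys p. Poly_Mapping.single u (Poly_Mapping.lookup p u))"
  by (rule poly_mapping_eqI) (auto simp: lookup_sum lookup_single when_def in_keys_iff sum.delta)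

lemma noetherian_mpoly_poly: "noetherian (UNIV :: ('n::finite, 'k::field) mpoly poly set)"
proof -
  define K :: "('n, 'k) mpoly poly set" where "K = range (\<lambda>c. [:Poly_Mapping.single 0 c:])"
  define X :: "'n \<Rightarrow> ('n, 'k) mpoly" where "X i = Poly_Mapping.single (Poly_Mapping.single i 1) 1" for i
  have "subring K"
    unfolding subring_def K_def
    by (auto simp: mult_single single_diff[symmetric] one_pCons single_one[symmetric] simp del: single_one)
  moreover have "noetherian K"
  proof (rule noetherian_field[OF _ \<open>subring K\<close>])
    fix x assume "x \<in> K" "x \<noteq> 0"
    then obtain c where c: "x = [:Poly_Mapping.single 0 c:]"
      unfolding K_def by blast
    with \<open>x \<noteq> 0\<close> have "c \<noteq> 0" by auto
    then have "[:Poly_Mapping.single 0 (inverse c):] * x = 1"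
      using c by (simp add: mult_single one_pCons)
    then show "\<exists>y\<in>K. y * x = 1" unfolding K_def by blast
  qed
  ultimately obtain S where S: "subring S" "noetherian S" "K \<subseteq> S"
      and gens: "insert [:0, 1:] ((\<lambda>i. [:X i:]) ` UNIV) \<subseteq> S"
    using noetherian_finite_extension[of "insert [:0, 1:] ((\<lambda>i. [:X i:]) ` UNIV)" K] by auto
  define T where "T = {p. [:p:] \<in> S}"
  have T_mult: "p * q \<in> T" if "p \<in> T" "q \<in> T" for p q
    using subring_mult[OF S(1), of "[:p:]" "[:q:]"] that unfolding T_def by (simp add: mult.commute)
  have T_one: "1 \<in> T" using S(1) unfolding T_def subring_def by (simp add: one_pCons)
  have T_zero: "0 \<in> T" using subring_zero[OF S(1)] unfolding T_def by simp
  have T_add: "p + q \<in> T" if "p \<in> T" "q \<in> T" for p q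
    using subring_add[OF S(1), of "[:p:]" "[:q:]"] that unfolding T_def by simp
  have T_sum: "sum f I \<in> T" if "\<And>i. i \<in> I \<Longrightarrow> f i \<in> T" for f :: "('n \<Rightarrow>\<^sub>0 nat) \<Rightarrow> _" and I
    using that by (induction I rule: infinite_finite_induct) (auto intro: T_add T_zero)
  have power_in: "Poly_Mapping.single (Poly_Mapping.single i k) 1 \<in> T" for i k
  proof (induction k)
    case 0
    then show ?case using T_one by simp
  next
    case (Suc k)
    have "X i * Poly_Mapping.single (Poly_Mapping.single i k) 1 \<in> T"
      using gens Suc by (intro T_mult) (auto simp: T_def)
    then show ?case by (simp add: X_def mult_single single_add[symmetric])
  qed
  have "Poly_Mapping.single (\<Sum>i\<in>J. Poly_Mapping.single i (Poly_Mapping.lookup u i)) 1 \<in> T"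
    if "finite J" for u J
    using that
  proof (induction J)
    case empty
    then show ?case using T_one by simp
  next
    case (insert j J)
    have "Poly_Mapping.single (Poly_Mapping.single j (Poly_Mapping.lookup u j)) 1 *
      Poly_Mapping.single (\<Sum>i\<in>J. Poly_Mapping.single i (Poly_Mapping.lookup u i)) 1 \<in> T"
      using insert power_in by (intro T_mult) auto
    then show ?case using insert by (simp add: mult_single)
  qed
  from this[OF finite_class.finite_UNIV] have monomial_in: "Poly_Mapping.single u 1 \<in> T" for u
    using monomial_as_sum[of u] by metis
  have "Poly_Mapping.single 0 c \<in> T" for c
    using S(3) unfolding T_def K_def by auto
  then have "Poly_Mapping.single 0 c * Poly_Mapping.single u 1 \<in> T" for u c
    using monomial_in by (intro T_mult) auto
  then have "Poly_Mapping.single u c \<in> T" for u c by (simp add: mult_single)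
  then have "p \<in> T" for p by (subst mpoly_as_sum) (intro T_sum)
  then have "[:p:] * [:0, 1:] ^ k \<in> S" for p k
    using gens by (intro subring_mult subring_power S) (auto simp: T_def)
  then have "monom p k \<in> S" for p k
    by (simp add: monom_altdef)
  then have "q \<in> S" for q
    by (subst poly_as_sum_of_monoms[symmetric]) (intro subring_sum[OF S(1)])
  then have "S = UNIV" by blast
  then show ?thesis using S by simp
qed

text \<open>
  The condition passes from \<open>A[t]\<close> to \<open>A\<close> along the evaluation at \<open>t = 0\<close>.
\<close>

lemma noetherian_mpoly: "noetherian (UNIV :: ('n::finite, 'k::field) mpoly set)"
  unfolding noetherian_def
proof (intro allI impI)
  fix a :: "nat \<Rightarrow> ('n, 'k) mpoly"
  obtain n where "[:a n:] \<in> rspan UNIV ((\<lambda>i. [:a i:]) ` {..<n})"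
    using noetherian_mpoly_poly[unfolded noetherian_def, rule_format, of "\<lambda>i. [:a i:]"] by auto
  then have "poly [:a n:] 0 \<in> rspan UNIV (a ` {..<n})"
    by induction (auto intro: rspan.intros)
  then show "\<exists>n. a n \<in> rspan UNIV (a ` {..<n})" by auto
qed

section \<open>Finitely generated submodules of free modules\<close>

lemma noetherian_ideal_fg:
  fixes J :: "'a::comm_ring_1 set"
  assumes noeth: "noetherian (UNIV :: 'a set)"
  shows "\<exists>F. finite F \<and> F \<subseteq> J \<and> J \<subseteq> rspan UNIV F"
proof (rule ccontr)
  assume contra: "\<not> ?thesis"
  have "\<exists>a. \<forall>k::nat. a k \<in> J \<and> a k \<notin> rspan UNIV (a ` {..<k})"
  proof (rule dependent_wellorder_choice)
    fix r and f g :: "nat \<Rightarrow> 'a" and k :: nat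
    assume "\<And>i. i < k \<Longrightarrow> f i = g i"
    then have "f ` {..<k} = g ` {..<k}" by (intro image_cong) auto
    then show "(r \<in> J \<and> r \<notin> rspan UNIV (f ` {..<k})) = (r \<in> J \<and> r \<notin> rspan UNIV (g ` {..<k}))"
      by simp
  next
    fix k :: nat and f :: "nat \<Rightarrow> 'a"
    assume "\<And>i. i < k \<Longrightarrow> f i \<in> J \<and> f i \<notin> rspan UNIV (f ` {..<i})"
    then have "finite (f ` {..<k}) \<and> f ` {..<k} \<subseteq> J" by auto
    then show "\<exists>r. r \<in> J \<and> r \<notin> rspan UNIV (f ` {..<k})" using contra by blast
  qed
  then show False using noeth unfolding noetherian_def by blast
qed

text \<open>
  Submodules of free modules with an arbitrary index set. This covers both \<open>F~\<close>, whose index set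
  is a type, and \<open>A\<^sup>r\<close> for varying \<open>r\<close>, represented by functions on the natural numbers.
\<close>

definition fun_submodule :: "('i \<Rightarrow> 'a::comm_ring_1) set \<Rightarrow> bool"
  where "fun_submodule N \<longleftrightarrow> (\<lambda>i. 0) \<in> N \<and>
    (\<forall>f\<in>N. \<forall>g\<in>N. (\<lambda>i. f i + g i) \<in> N) \<and> (\<forall>r. \<forall>f\<in>N. (\<lambda>i. r * f i) \<in> N)"

lemma fun_submodule_lincomb:
  assumes "fun_submodule N" "finite B" "B \<subseteq> N"
  shows "(\<lambda>i. \<Sum>b\<in>B. c b * b i) \<in> N"
  using assms(2,3)
proof (induction B)
  case empty
  then show ?case using assms(1) unfolding fun_submodule_def by simp
next
  case (insert b B)
  then have "(\<lambda>i. c b * b i) \<in> N" "(\<lambda>i. \<Sum>b\<in>B. c b * b i) \<in> N"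
    using assms(1) unfolding fun_submodule_def by auto
  then have "(\<lambda>i. c b * b i + (\<Sum>b\<in>B. c b * b i)) \<in> N"
    using assms(1) unfolding fun_submodule_def by fast
  then show ?case using insert by simp
qed

text \<open>
  Induction on the number of coordinates that have to be matched: the coordinates at \<open>x\<close> of
  elements of \<open>N\<close> form a finitely generated ideal, and subtracting a combination of lifts of its
  generators leaves an element of \<open>N\<close> vanishing at \<open>x\<close>. Values outside \<open>S\<close> are ignored, which suits
  elements of \<open>A\<^sup>r\<close> represented by functions of which only the values below \<open>r\<close> matter.
\<close>

lemma fun_submodule_fg:
  fixes N :: "('i \<Rightarrow> 'a::comm_ring_1) set"
  assumes noeth: "noetherian (UNIV :: 'a set)" and "finite S" "fun_submodule N"
  shows "\<exists>B. finite B \<and> B \<subseteq> N \<and> (\<forall>f\<in>N. \<exists>c. \<forall>i\<in>S. f i = (\<Sum>b\<in>B. c b * b i))"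
  using assms(2,3)
proof (induction S arbitrary: N)
  case empty
  then show ?case by (intro exI[of _ "{}"]) auto
next
  case (insert x S)
  obtain F where F: "finite F" "F \<subseteq> (\<lambda>f. f x) ` N" "(\<lambda>f. f x) ` N \<subseteq> rspan UNIV F"
    using noetherian_ideal_fg[OF noeth, of "(\<lambda>f. f x) ` N"] by blast
  then obtain B1 where B1: "finite B1" "B1 \<subseteq> N" "F = (\<lambda>f. f x) ` B1"
    using finite_subset_image by metis
  have lift: "\<exists>c. z = (\<Sum>b\<in>B1. c b * b x)" if "z \<in> rspan UNIV F" for z
    using that
  proof induction
    case zero
    then show ?case by (intro exI[of _ "\<lambda>_. 0"]) simp
  next
    case (step r b z)
    then obtain c b' where c: "z = (\<Sum>b\<in>B1. c b * b x)" "b' \<in> B1" "b = b' x"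
      using B1 by blast
    have "(\<Sum>b\<in>B1. (c b + (if b = b' then r else 0)) * b x)
        = (\<Sum>b\<in>B1. c b * b x + (if b = b' then r * b x else 0))"
      by (intro sum.cong) (auto simp: distrib_right)
    also have "\<dots> = r * b + z"
      using c B1 by (simp add: sum.distrib)
    finally show ?case by (intro exI) (rule sym)
  qed
  \<comment> \<open>the elements for which only the coordinates in \<open>S\<close> remain to be matched\<close>
  define N' where "N' = {f \<in> N. f x = 0}"
  have "fun_submodule N'"
    using insert.prems unfolding N'_def fun_submodule_def by auto
  then obtain B2 where B2: "finite B2" "B2 \<subseteq> N'"
    "\<forall>f\<in>N'. \<exists>c. \<forall>i\<in>S. f i = (\<Sum>b\<in>B2. c b * b i)"
    using insert.IH by meson
  have "\<exists>c. \<forall>i\<in>insert x S. f i = (\<Sum>b\<in>B1 \<union> B2. c b * b i)" if f: "f \<in> N" for f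
  proof -
    obtain c where c: "f x = (\<Sum>b\<in>B1. c b * b x)"
      using lift[of "f x"] F f by blast
    define h where "h = (\<lambda>i. \<Sum>b\<in>B1. c b * b i)"
    have "h \<in> N" unfolding h_def by (rule fun_submodule_lincomb[OF insert.prems B1(1,2)])
    then have "(\<lambda>i. (- 1) * h i) \<in> N"
      using insert.prems unfolding fun_submodule_def by blast
    then have "(\<lambda>i. f i + (- 1) * h i) \<in> N"
      using f insert.prems unfolding fun_submodule_def by fast
    then have "(\<lambda>i. f i - h i) \<in> N'" unfolding N'_def using c by (simp add: h_def)
    then obtain c' where c': "\<And>i. i \<in> S \<Longrightarrow> f i - h i = (\<Sum>b\<in>B2. c' b * b i)"
      using B2(3)[rule_format, of "\<lambda>i. f i - h i"] by auto
    let ?c = "\<lambda>b. (if b \<in> B1 then c b else 0) + (if b \<in> B2 then c' b else 0)"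
    have split: "(\<Sum>b\<in>B1 \<union> B2. ?c b * b i) = h i + (\<Sum>b\<in>B2. c' b * b i)" for i
    proof -
      have "(\<Sum>b\<in>B1 \<union> B2. ?c b * b i) =
        (\<Sum>b\<in>B1 \<union> B2. (if b \<in> B1 then c b * b i else 0)) +
        (\<Sum>b\<in>B1 \<union> B2. (if b \<in> B2 then c' b * b i else 0))"
        unfolding sum.distrib[symmetric] by (intro sum.cong) (auto simp: algebra_simps)
      also have "\<dots> = h i + (\<Sum>b\<in>B2. c' b * b i)"
        using B1 B2 by (simp add: sum.inter_restrict[symmetric] Int_absorb1 h_def)
      finally show ?thesis .
    qed
    have "(\<Sum>b\<in>B2. c' b * b x) = 0"
      using B2 unfolding N'_def by (intro sum.neutral) auto
    then have "\<forall>i\<in>insert x S. f i = (\<Sum>b\<in>B1 \<union> B2. ?c b * b i)"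
      using c c' unfolding split h_def by (auto simp: algebra_simps)
    then show ?thesis by (rule exI[of _ ?c])
  qed
  then show ?case
    using B1 B2 unfolding N'_def by (intro exI[of _ "B1 \<union> B2"]) auto
qed

text \<open>
  The union of the chain is finitely generated, and finitely many generators already lie in one
  member of the chain.
\<close>

lemma no_increasing_spans:
  fixes B :: "nat \<Rightarrow> ('a::comm_ring_1 ^ 'm::finite) set"
  assumes noeth: "noetherian (UNIV :: 'a set)"
    and increasing: "\<And>k. submodule_span (B k) \<subset> submodule_span (B (Suc k))"
  shows False
proof -
  let ?U = "\<Union>k. submodule_span (B k)"
  have chain: "submodule_span (B k) \<subseteq> submodule_span (B l)" if "k \<le> l" for k l
    by (rule lift_Suc_mono_le[of "\<lambda>k. submodule_span (B k)"]) (use increasing that in auto)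
  have "fun_submodule (vec_nth ` ?U)"
    unfolding fun_submodule_def
  proof (intro conjI ballI allI)
    show "(\<lambda>i. 0) \<in> vec_nth ` ?U"
      using vmod.span_zero by (intro image_eqI[of _ _ 0]) (auto simp: fun_eq_iff)
    fix f assume "f \<in> vec_nth ` ?U"
    then obtain p k where p: "p \<in> submodule_span (B k)" "f = vec_nth p" by auto
    have "r *s p \<in> ?U" for r using p vmod.span_scale by blast
    then show "(\<lambda>i. r * f i) \<in> vec_nth ` ?U" for r
      using p by (intro image_eqI[of _ _ "r *s p"]) (auto simp: fun_eq_iff)
    fix g assume "g \<in> vec_nth ` ?U"
    then obtain q l where q: "q \<in> submodule_span (B l)" "g = vec_nth q" by auto
    have "p \<in> submodule_span (B (max k l))" "q \<in> submodule_span (B (max k l))"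
      using p q chain[of k "max k l"] chain[of l "max k l"] by auto
    then have "p + q \<in> ?U" using vmod.span_add by blast
    then show "(\<lambda>i. f i + g i) \<in> vec_nth ` ?U"
      using p q by (intro image_eqI[of _ _ "p + q"]) (auto simp: fun_eq_iff)
  qed
  from fun_submodule_fg[OF noeth finite_class.finite_UNIV this]
  obtain C where C: "finite C" "C \<subseteq> vec_nth ` ?U"
    and C_gen: "\<forall>f \<in> vec_nth ` ?U. \<exists>c. \<forall>i\<in>UNIV. f i = (\<Sum>b\<in>C. c b * b i)"
    by (elim exE conjE)
  have "\<exists>n. C \<subseteq> vec_nth ` submodule_span (B n)"
    using C
  proof (induction C)
    case empty
    then show ?case by auto
  next
    case (insert b C)
    then obtain n k where "C \<subseteq> vec_nth ` submodule_span (B n)" "b \<in> vec_nth ` submodule_span (B k)"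
      by auto
    then have "insert b C \<subseteq> vec_nth ` submodule_span (B (max n k))"
      using chain[of n "max n k"] chain[of k "max n k"] by fastforce
    then show ?case by blast
  qed
  then obtain n where n: "C \<subseteq> vec_nth ` submodule_span (B n)" by blast
  have "q \<in> submodule_span (B n)" if "q \<in> submodule_span (B (Suc n))" for q
  proof -
    have "vec_nth q \<in> vec_nth ` ?U" using that by blast
    then obtain c where "\<forall>i\<in>UNIV. q $ i = (\<Sum>b\<in>C. c b * b i)"
      using bspec[OF C_gen] by meson
    then have "q = (\<Sum>b\<in>C. c b *s vec_lambda b)"
      by (simp add: vec_eq_iff)
    moreover have "vec_lambda b \<in> submodule_span (B n)" if "b \<in> C" for b
      using n that by (auto simp: vec_lambda_eta)
    ultimately show ?thesis
      by (auto intro!: vmod.span_sum vmod.span_scale)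
  qed
  then show False using increasing[of n] by blast
qed

section \<open>Homogenization, dehomogenization and initial forms\<close>

lemma vec_poly_eqI:
  fixes p q :: "('n, 'k::zero) mpoly poly ^ 'm"
  assumes "\<And>j k u. Poly_Mapping.lookup (coeff (p $ j) k) u = Poly_Mapping.lookup (coeff (q $ j) k) u"
  shows "p = q"
  using assms by (auto simp: vec_eq_iff poly_eq_iff intro!: poly_mapping_eqI)

lemma finite_monomials: "finite (monomials (f :: ('n, 'k::zero) mpoly ^ 'm::finite))"
proof -
  have "monomials f = (\<Union>j. Poly_Mapping.keys (f $ j) \<times> {j})"
    unfolding monomials_def by auto
  then show ?thesis by simp
qed

lemma weight_le_max_weight:
  fixes f :: "('n::finite, 'k::zero) mpoly ^ 'm::finite"
  assumes "u \<in> Poly_Mapping.keys (f $ j)"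
  shows "wdeg w u + \<epsilon> j \<le> max_weight w \<epsilon> f"
  unfolding max_weight_def using assms finite_monomials[of f]
  by (intro Max_ge) (auto simp: monomials_def intro!: rev_image_eqI[of "(u, j)"])

lemma max_weight_attained:
  fixes f :: "('n::finite, 'k::zero) mpoly ^ 'm::finite"
  assumes "f \<noteq> 0"
  obtains u j where "u \<in> Poly_Mapping.keys (f $ j)" "wdeg w u + \<epsilon> j = max_weight w \<epsilon> f"
proof -
  obtain j where "f $ j \<noteq> 0" using assms by (auto simp: vec_eq_iff)
  then obtain u where "Poly_Mapping.lookup (f $ j) u \<noteq> 0"
    by (metis lookup_zero poly_mapping_eqI)
  then have "(u, j) \<in> monomials f" unfolding monomials_def by (simp add: in_keys_iff)
  then have "max_weight w \<epsilon> f \<in> (\<lambda>(u, j). wdeg w u + \<epsilon> j) ` monomials f"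
    unfolding max_weight_def by (intro Max_in finite_imageI finite_monomials) auto
  then show ?thesis using that unfolding monomials_def by auto
qed

lemma lookup_homogenization:
  "Poly_Mapping.lookup (coeff (homogenization w \<epsilon> f $ j) k) u =
    (if wdeg w u + k + \<epsilon> j = max_weight w \<epsilon> f then Poly_Mapping.lookup (f $ j) u else 0)"
proof -
  let ?K = "Poly_Mapping.keys (f $ j)" and ?c = "Poly_Mapping.lookup (f $ j)"
  have summand: "Poly_Mapping.lookup (coeff (monom (Poly_Mapping.single v (?c v))
      (max_weight w \<epsilon> f - (wdeg w v + \<epsilon> j))) k) u =
    (if v = u then (if max_weight w \<epsilon> f - (wdeg w u + \<epsilon> j) = k then ?c u else 0) else 0)" for v
    by (auto simp: lookup_single when_def)
  have "Poly_Mapping.lookup (coeff (homogenization w \<epsilon> f $ j) k) u =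
    (\<Sum>v\<in>?K. if v = u then (if max_weight w \<epsilon> f - (wdeg w u + \<epsilon> j) = k then ?c u else 0) else 0)"
    unfolding homogenization_def
    by (simp only: vec_lambda_beta coeff_sum lookup_sum summand)
  also have "\<dots> = (if u \<in> ?K \<and> max_weight w \<epsilon> f - (wdeg w u + \<epsilon> j) = k then ?c u else 0)"
    by simp
  also have "\<dots> = (if wdeg w u + k + \<epsilon> j = max_weight w \<epsilon> f then ?c u else 0)"
    using weight_le_max_weight[of u f j w \<epsilon>] by (auto simp: in_keys_iff)
  finally show ?thesis .
qed

lemma homogenization_zero: "homogenization w \<epsilon> 0 = 0"
  by (rule vec_poly_eqI) (simp add: lookup_homogenization)

text \<open>
  Evaluation at \<open>t = 0\<close> and at \<open>t = 1\<close> are both needed: the former yields initial forms, the latter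
  undoes homogenization.
\<close>

definition eval_t :: "'a::comm_ring_1 \<Rightarrow> 'a poly ^ 'm \<Rightarrow> 'a ^ 'm"
  where "eval_t a q = (\<chi> j. poly (q $ j) a)"

lemma eval_t0_eq: "eval_t0 = eval_t 0"
  by (simp add: fun_eq_iff eval_t_def eval_t0_def)

lemma eval_t_add: "eval_t a (p + q) = eval_t a p + eval_t a q"
  by (simp add: eval_t_def vec_eq_iff)

lemma eval_t_scale: "eval_t a (p *s q) = poly p a *s eval_t a q"
  by (simp add: eval_t_def vec_eq_iff)

lemma eval_t_zero: "eval_t a 0 = 0"
  by (simp add: eval_t_def vec_eq_iff)

lemma eval_t_sum: "eval_t a (sum f I) = (\<Sum>i\<in>I. eval_t a (f i))"
  by (induction I rule: infinite_finite_induct) (simp_all add: eval_t_zero eval_t_add)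

lemma eval_t_span: "eval_t a ` submodule_span B = submodule_span (eval_t a ` B)"
proof (intro equalityI subsetI)
  fix f assume "f \<in> eval_t a ` submodule_span B"
  then obtain q where "q \<in> submodule_span B" "f = eval_t a q" by blast
  then show "f \<in> submodule_span (eval_t a ` B)"
  proof (induction arbitrary: f rule: vmod.span_induct_alt)
    case base
    then show ?case by (simp add: eval_t_zero vmod.span_zero)
  next
    case (step c x y)
    then show ?case
      by (simp add: eval_t_add eval_t_scale vmod.span_add vmod.span_scale vmod.span_base)
  qed
next
  fix f assume "f \<in> submodule_span (eval_t a ` B)"
  then show "f \<in> eval_t a ` submodule_span B"
  proof (induction rule: vmod.span_induct_alt)
    case base
    then show ?case using vmod.span_zero by (intro image_eqI[of _ _ 0]) (auto simp: eval_t_zero)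
  next
    case (step c x y)
    then obtain p q where "p \<in> B" "x = eval_t a p" "q \<in> submodule_span B" "y = eval_t a q" by blast
    then have "[:c:] *s p + q \<in> submodule_span B" "c *s x + y = eval_t a ([:c:] *s p + q)"
      by (auto simp: eval_t_add eval_t_scale intro: vmod.span_add vmod.span_scale vmod.span_base)
    then show ?case by blast
  qed
qed

lemma eval_t1_homogenization: "eval_t 1 (homogenization w \<epsilon> f) = f"
  by (simp add: eval_t_def homogenization_def vec_eq_iff poly_sum poly_monom mpoly_as_sum[symmetric])

lemma eval_t0_homogenization:
  "eval_t 0 (homogenization w \<epsilon> f) = initial_form w \<epsilon> f"
proof -
  let ?d = "max_weight w \<epsilon> f"
  have "poly (homogenization w \<epsilon> f $ j) 0 = initial_form w \<epsilon> f $ j" for j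
  proof -
    let ?K = "Poly_Mapping.keys (f $ j)"
    let ?s = "\<lambda>u. Poly_Mapping.single u (Poly_Mapping.lookup (f $ j) u)"
    have "poly (homogenization w \<epsilon> f $ j) 0 = (\<Sum>u\<in>?K. if wdeg w u + \<epsilon> j = ?d then ?s u else 0)"
    proof -
      have "?d - (wdeg w u + \<epsilon> j) = 0 \<longleftrightarrow> wdeg w u + \<epsilon> j = ?d" if "u \<in> ?K" for u
        using weight_le_max_weight[OF that, of w \<epsilon>] by linarith
      then show ?thesis
        unfolding homogenization_def
        by (simp add: poly_sum poly_monom power_0_left del: diff_is_0_eq) (auto intro!: sum.cong)
    qed
    also have "\<dots> = initial_form w \<epsilon> f $ j"
      by (simp add: initial_form_def sum.inter_filter)
    finally show ?thesis .
  qed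
  then show ?thesis by (simp add: eval_t_def vec_eq_iff)
qed

definition weight_homogeneous ::
    "('n::finite \<Rightarrow> nat) \<Rightarrow> ('m \<Rightarrow> nat) \<Rightarrow> nat \<Rightarrow> ('n, 'k::zero) mpoly poly ^ 'm \<Rightarrow> bool"
  where "weight_homogeneous w \<epsilon> e q \<longleftrightarrow>
    (\<forall>j k. \<forall>u\<in>Poly_Mapping.keys (coeff (q $ j) k). wdeg w u + k + \<epsilon> j = e)"

lemma weight_homogeneous_homogenization:
  "weight_homogeneous w \<epsilon> (max_weight w \<epsilon> f) (homogenization w \<epsilon> f)"
  unfolding weight_homogeneous_def
  by (auto simp: in_keys_iff lookup_homogenization split: if_splits)

lemma bihomogeneous_imp_weight_homogeneous:
  assumes "bihomogeneous w d \<epsilon> q"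
  obtains e where "weight_homogeneous w \<epsilon> e q"
proof -
  obtain b where b: "bihomogeneous_of w d \<epsilon> b q" using assms unfolding bihomogeneous_def by blast
  have "weight_homogeneous w \<epsilon> (nat (snd b)) q"
    unfolding weight_homogeneous_def
  proof (intro allI ballI)
    fix j k u assume "u \<in> Poly_Mapping.keys (coeff (q $ j) k)"
    then have "int (wdeg w u + k + \<epsilon> j) = snd b"
      using b unfolding bihomogeneous_of_def by force
    then show "wdeg w u + k + \<epsilon> j = nat (snd b)" by linarith
  qed
  then show ?thesis by (rule that)
qed

lemma lookup_poly_one:
  fixes p :: "('n, 'k::comm_ring_1) mpoly poly"
  shows "Poly_Mapping.lookup (poly p 1) u = (\<Sum>k\<le>degree p. Poly_Mapping.lookup (coeff p k) u)"
  by (simp add: poly_altdef lookup_sum)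

text \<open>
  Evaluation at \<open>t = 1\<close> causes no cancellation on weight-homogeneous elements, as each monomial
  \<open>X\<^sup>u e\<^sub>j\<close> occurs with at most one power of \<open>t\<close>.
\<close>

lemma lookup_weight_homogeneous:
  fixes q :: "('n::finite, 'k::field) mpoly poly ^ 'm::finite"
  assumes "weight_homogeneous w \<epsilon> e q"
  shows "Poly_Mapping.lookup (coeff (q $ j) k) u =
    (if wdeg w u + k + \<epsilon> j = e then Poly_Mapping.lookup (eval_t 1 q $ j) u else 0)"
proof (cases "wdeg w u + k + \<epsilon> j = e")
  case False
  then show ?thesis using assms unfolding weight_homogeneous_def by (metis in_keys_iff)
next
  case True
  have other: "Poly_Mapping.lookup (coeff (q $ j) i) u = 0" if "i \<noteq> k" for i
    using assms that True unfolding weight_homogeneous_def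
    by (metis add_left_cancel add_right_cancel in_keys_iff)
  have "Poly_Mapping.lookup (eval_t 1 q $ j) u =
    (\<Sum>i\<le>degree (q $ j). if i = k then Poly_Mapping.lookup (coeff (q $ j) k) u else 0)"
    unfolding eval_t_def vec_lambda_beta lookup_poly_one by (rule sum.cong) (auto simp: other)
  also have "\<dots> = Poly_Mapping.lookup (coeff (q $ j) k) u"
    by (auto simp: coeff_eq_0)
  finally show ?thesis using True by simp
qed

lemma weight_homogeneous_eq_homogenization:
  fixes q :: "('n::finite, 'k::field) mpoly poly ^ 'm::finite"
  assumes q: "weight_homogeneous w \<epsilon> e q"
  obtains n where "q = monom 1 n *s homogenization w \<epsilon> (eval_t 1 q)"
proof (cases "eval_t 1 q = 0")
  case True
  have "q = 0"
    by (rule vec_poly_eqI) (simp add: lookup_weight_homogeneous[OF q] True)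
  then show ?thesis using that[of 0] True by (simp add: homogenization_zero)
next
  case False
  let ?f = "eval_t 1 q"
  let ?d = "max_weight w \<epsilon> ?f"
  obtain u j where uj: "u \<in> Poly_Mapping.keys (?f $ j)" "wdeg w u + \<epsilon> j = ?d"
    using max_weight_attained[OF False] by blast
  then have "Poly_Mapping.lookup (poly (q $ j) 1) u \<noteq> 0"
    by (simp add: eval_t_def in_keys_iff)
  then obtain k where "Poly_Mapping.lookup (coeff (q $ j) k) u \<noteq> 0"
    unfolding lookup_poly_one by (meson sum.neutral)
  then have "wdeg w u + k + \<epsilon> j = e"
    using q unfolding weight_homogeneous_def by (simp add: in_keys_iff)
  then have "?d \<le> e" using uj by simp
  have "q = monom 1 (e - ?d) *s homogenization w \<epsilon> ?f"
  proof (rule vec_poly_eqI)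
    fix j k u
    have *: "Poly_Mapping.lookup (?f $ j) u = 0 \<or> wdeg w u + \<epsilon> j \<le> ?d"
      using weight_le_max_weight[of u ?f j w \<epsilon>] by (auto simp: in_keys_iff)
    show "Poly_Mapping.lookup (coeff (q $ j) k) u =
      Poly_Mapping.lookup (coeff ((monom 1 (e - ?d) *s homogenization w \<epsilon> ?f) $ j) k) u"
      using * \<open>?d \<le> e\<close>
      by (auto simp: lookup_weight_homogeneous[OF q, of j k u] coeff_monom_mult lookup_homogenization)
  qed
  then show ?thesis by (rule that)
qed

lemma homogenization_in_homogenized_module:
  "f \<in> M \<Longrightarrow> homogenization w \<epsilon> f \<in> homogenized_module w \<epsilon> M"
  unfolding homogenized_module_def
  by (cases "f = 0") (auto simp: homogenization_zero intro: vmod.span_zero vmod.span_base)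

text \<open>
  Together with \<open>eval_t1_homogenized_module\<close> this shows that, for a submodule \<open>M\<close>, membership of
  weight-homogeneous elements in \<open>M~\<close> can be tested at \<open>t = 1\<close>, where \<open>q\<close> and \<open>t q\<close> agree.
\<close>

lemma weight_homogeneous_in_homogenized_module:
  assumes "weight_homogeneous w \<epsilon> e q" "eval_t 1 q \<in> M"
  shows "q \<in> homogenized_module w \<epsilon> M"
proof -
  obtain n where n: "q = monom 1 n *s homogenization w \<epsilon> (eval_t 1 q)"
    using weight_homogeneous_eq_homogenization[OF assms(1)] by blast
  have "monom 1 n *s homogenization w \<epsilon> (eval_t 1 q) \<in> homogenized_module w \<epsilon> M"
    using homogenization_in_homogenized_module[OF assms(2)]
    unfolding homogenized_module_def by (rule vmod.span_scale)
  then show ?thesis by (subst n)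
qed

lemma eval_t1_homogenized_module:
  assumes "q \<in> homogenized_module w \<epsilon> M"
  shows "eval_t 1 q \<in> submodule_span M"
proof -
  have "eval_t 1 ` {homogenization w \<epsilon> f | f. f \<in> M \<and> f \<noteq> 0} \<subseteq> M"
    by (auto simp: eval_t1_homogenization)
  then have "eval_t 1 ` homogenized_module w \<epsilon> M \<subseteq> submodule_span M"
    unfolding homogenized_module_def eval_t_span by (rule vmod.span_mono)
  then show ?thesis using assms by blast
qed

lemma eval_t0_homogenized_module:
  "eval_t0 ` homogenized_module w \<epsilon> M = initial_module w \<epsilon> M"
proof -
  have "eval_t 0 ` {homogenization w \<epsilon> f | f. f \<in> M \<and> f \<noteq> 0} = {initial_form w \<epsilon> f | f. f \<in> M \<and> f \<noteq> 0}"
    by (auto simp: eval_t0_homogenization[symmetric])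
  then show ?thesis
    by (simp add: homogenized_module_def initial_module_def eval_t0_eq eval_t_span)
qed

lemma t_times_eq_iff: "t_times p = t_times q \<longleftrightarrow> p = q"
  by (auto simp: t_times_def vec_eq_iff)

lemma t_times_add: "t_times (p + q) = t_times p + t_times q"
  by (simp add: t_times_def vec_eq_iff algebra_simps)

lemma t_times_scale: "t_times (a *s q) = a *s t_times q"
  by (simp add: t_times_def vec_eq_iff algebra_simps)

lemma t_times_zero: "t_times 0 = 0"
  by (simp add: t_times_def vec_eq_iff)

lemma t_times_sum: "t_times (sum f I) = (\<Sum>i\<in>I. t_times (f i))"
  by (induction I rule: infinite_finite_induct) (simp_all add: t_times_zero t_times_add)

lemma eval_t1_t_times: "eval_t 1 (t_times q) = eval_t 1 q"
  by (simp add: t_times_def eval_t_def vec_eq_iff)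

lemma coeff_t_times: "coeff (t_times q $ j) k = (case k of 0 \<Rightarrow> 0 | Suc l \<Rightarrow> coeff (q $ j) l)"
  by (simp add: t_times_def coeff_pCons split: nat.split)

lemma weight_homogeneous_t_times:
  assumes "weight_homogeneous w \<epsilon> e q"
  shows "weight_homogeneous w \<epsilon> (Suc e) (t_times q)"
  using assms unfolding weight_homogeneous_def
  by (auto simp: coeff_t_times split: nat.splits)

lemma eval_t0_zero_obtains:
  fixes h :: "('n, 'k::field) mpoly poly ^ 'm::finite"
  assumes "eval_t0 h = 0"
  obtains q where "h = t_times q"
proof -
  have "\<exists>p. h $ j = pCons 0 p" for j
  proof -
    obtain a p where "h $ j = pCons a p" by (rule pCons_cases)
    moreover have "poly (h $ j) 0 = 0" using assms by (simp add: eval_t0_def vec_eq_iff)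
    ultimately show ?thesis by auto
  qed
  then obtain p where "\<And>j. h $ j = pCons 0 (p j)" by metis
  then have "h = t_times (\<chi> j. p j)" by (simp add: t_times_def vec_eq_iff)
  then show ?thesis by (rule that)
qed

text \<open>
  The elements of \<open>F\<close> with a weight-homogeneous lift in \<open>N\<close> form a submodule. Lifts of different
  weights are made comparable by multiplying with powers of \<open>t\<close>, and a polynomial coefficient is
  handled monomial by monomial, because only monomials preserve weight-homogeneity.
  Terms of top weight may cancel in a linear combination of the generators, so \<open>q\<close> is in general
  only a multiple of the homogenization of \<open>f\<close> by a power of \<open>t\<close>.
\<close>

lemma weight_homogeneous_lift:
  fixes f :: "('n::finite, 'k::field) mpoly ^ 'm::finite"
  assumes N: "\<And>x y. x \<in> N \<Longrightarrow> y \<in> N \<Longrightarrow> x + y \<in> N" "\<And>a x. x \<in> N \<Longrightarrow> a *s x \<in> N" "0 \<in> N"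
    and gens: "\<And>g. g \<in> B \<Longrightarrow> homogenization w \<epsilon> g \<in> N"
    and f: "f \<in> submodule_span B"
  obtains e q where "weight_homogeneous w \<epsilon> e q" "q \<in> N" "eval_t 1 q = f"
proof -
  define lifts where "lifts f \<longleftrightarrow> (\<exists>e q. weight_homogeneous w \<epsilon> e q \<and> q \<in> N \<and> eval_t 1 q = f)" for f
  have raise: "\<exists>q'. weight_homogeneous w \<epsilon> (n + e) q' \<and> q' \<in> N \<and> eval_t 1 q' = eval_t 1 q"
    if "weight_homogeneous w \<epsilon> e q" "q \<in> N" for n e q
  proof (induction n)
    case 0
    then show ?case using that by auto
  next
    case (Suc n)
    then obtain q' where "weight_homogeneous w \<epsilon> (n + e) q'" "q' \<in> N" "eval_t 1 q' = eval_t 1 q" by blast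
    then have "weight_homogeneous w \<epsilon> (Suc n + e) (t_times q')" "t_times q' \<in> N"
      "eval_t 1 (t_times q') = eval_t 1 q"
      using weight_homogeneous_t_times N(2) by (auto simp: eval_t1_t_times) (simp add: t_times_def N(2))
    then show ?case by blast
  qed
  have add: "lifts (f + g)" if fg: "lifts f" "lifts g" for f g
  proof -
    obtain e q e' q' where q: "weight_homogeneous w \<epsilon> e q" "q \<in> N" "eval_t 1 q = f"
      and q': "weight_homogeneous w \<epsilon> e' q'" "q' \<in> N" "eval_t 1 q' = g"
      using fg unfolding lifts_def by blast
    obtain p where p: "weight_homogeneous w \<epsilon> (e' + e) p" "p \<in> N" "eval_t 1 p = f"
      using raise[OF q(1,2), of e'] q(3) by blast
    obtain p' where p': "weight_homogeneous w \<epsilon> (e' + e) p'" "p' \<in> N" "eval_t 1 p' = g"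
      using raise[OF q'(1,2), of e] q'(3) by (metis add.commute)
    have "weight_homogeneous w \<epsilon> (e' + e) (p + p')"
      using p p' keys_add unfolding weight_homogeneous_def by fastforce
    then show ?thesis using p p' N(1) unfolding lifts_def by (metis eval_t_add)
  qed
  have monomial: "lifts (Poly_Mapping.single v c *s f)" if f: "lifts f" for v c f
  proof -
    obtain e q where q: "weight_homogeneous w \<epsilon> e q" "q \<in> N" "eval_t 1 q = f"
      using f unfolding lifts_def by blast
    let ?q = "[:Poly_Mapping.single v c:] *s q"
    have "weight_homogeneous w \<epsilon> (wdeg w v + e) ?q"
      unfolding weight_homogeneous_def
    proof (intro allI ballI)
      fix j k u assume "u \<in> Poly_Mapping.keys (coeff (?q $ j) k)"
      then have "u \<in> Poly_Mapping.keys (Poly_Mapping.single v c * coeff (q $ j) k)" by simp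
      then obtain u' where "u = v + u'" "u' \<in> Poly_Mapping.keys (coeff (q $ j) k)"
        using keys_mult[of "Poly_Mapping.single v c" "coeff (q $ j) k"] by (auto split: if_splits)
      then show "wdeg w u + k + \<epsilon> j = wdeg w v + e"
        using q(1) unfolding weight_homogeneous_def
        by (force simp: wdeg_def lookup_add algebra_simps sum.distrib)
    qed
    moreover have "?q \<in> N" "eval_t 1 ?q = Poly_Mapping.single v c *s f"
      using q N(2) by (auto simp: eval_t_scale)
    ultimately show ?thesis unfolding lifts_def by blast
  qed
  have zero: "lifts 0"
    unfolding lifts_def
    by (intro exI[of _ 0]) (auto simp: N(3) eval_t_zero weight_homogeneous_def)
  have scale: "lifts (p *s f)" if "lifts f" for p f
  proof -
    have "lifts ((\<Sum>v\<in>V. Poly_Mapping.single v (Poly_Mapping.lookup p v)) *s f)" if "finite V" for V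
      using that
    proof induction
      case empty
      then show ?case using zero by simp
    next
      case (insert v V)
      then show ?case using add monomial[OF \<open>lifts f\<close>] by (simp add: vmod.scale_left_distrib)
    qed
    then show ?thesis by (subst mpoly_as_sum) simp
  qed
  have "lifts f"
    using f
  proof (induction rule: vmod.span_induct_alt)
    case base
    then show ?case by (rule zero)
  next
    case (step c x y)
    have "lifts x"
      unfolding lifts_def
      using gens[OF step(1)] weight_homogeneous_homogenization eval_t1_homogenization by blast
    then show ?case using step by (intro add scale)
  qed
  then show ?thesis using that unfolding lifts_def by blast
qed

section \<open>Bihomogeneous syzygies\<close>

definition bideg :: "('n::finite \<Rightarrow> nat) \<Rightarrow> ('n \<Rightarrow>\<^sub>0 nat) \<Rightarrow> int \<times> int"
  where "bideg w u = (int (tdeg u), int (wdeg w u))"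

lemma bideg_add: "bideg w (u + v) = bideg w u + bideg w v"
  by (simp add: bideg_def tdeg_def wdeg_def lookup_add sum.distrib algebra_simps)

lemma bihomogeneous_poly_iff:
  "bihomogeneous_poly w b p \<longleftrightarrow> (\<forall>u. Poly_Mapping.lookup p u \<noteq> 0 \<longrightarrow> bideg w u = b)"
  by (auto simp: bihomogeneous_poly_def bideg_def in_keys_iff)

lemma bihomogeneous_of_iff:
  "bihomogeneous_of w d \<epsilon> b q \<longleftrightarrow> (\<forall>j k u. Poly_Mapping.lookup (coeff (q $ j) k) u \<noteq> 0 \<longrightarrow>
    bideg w u + (d j, int k + int (\<epsilon> j)) = b)"
  unfolding bihomogeneous_of_def bideg_def by (auto simp: in_keys_iff algebra_simps Ball_def)

lemma lookup_mult_nonzero: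
  assumes "Poly_Mapping.lookup (p * q) m \<noteq> 0"
  obtains u v where "m = u + v" "Poly_Mapping.lookup p u \<noteq> 0" "Poly_Mapping.lookup q v \<noteq> 0"
  using assms keys_mult[of p q] by (fastforce simp: in_keys_iff)

lemma bihomogeneous_of_scale:
  fixes q :: "('n::finite, 'k::field) mpoly poly ^ 'm"
  assumes "bihomogeneous_poly w b p" "bihomogeneous_of w d \<epsilon> c q"
  shows "bihomogeneous_of w d \<epsilon> (b + c) ([:p:] *s q)"
  unfolding bihomogeneous_of_iff
proof (intro allI impI)
  fix j k m assume "Poly_Mapping.lookup (coeff (([:p:] *s q) $ j) k) m \<noteq> 0"
  then have "Poly_Mapping.lookup (p * coeff (q $ j) k) m \<noteq> 0" by simp
  then obtain u v where uv: "m = u + v" "Poly_Mapping.lookup p u \<noteq> 0"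
      "Poly_Mapping.lookup (coeff (q $ j) k) v \<noteq> 0"
    by (rule lookup_mult_nonzero)
  then have "bideg w u = b" "bideg w v + (d j, int k + int (\<epsilon> j)) = c"
    using assms unfolding bihomogeneous_poly_iff bihomogeneous_of_iff by auto
  then show "bideg w m + (d j, int k + int (\<epsilon> j)) = b + c"
    using uv by (auto simp: bideg_add add.assoc)
qed

lemma bihomogeneous_of_sum:
  fixes q :: "'i \<Rightarrow> ('n::finite, 'k::field) mpoly poly ^ 'm::finite"
  assumes "\<And>i. i \<in> I \<Longrightarrow> bihomogeneous_of w d \<epsilon> b (q i)"
  shows "bihomogeneous_of w d \<epsilon> b (sum q I)"
  unfolding bihomogeneous_of_iff
proof (intro allI impI)
  fix j k u assume "Poly_Mapping.lookup (coeff (sum q I $ j) k) u \<noteq> 0"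
  then have "(\<Sum>i\<in>I. Poly_Mapping.lookup (coeff (q i $ j) k) u) \<noteq> 0"
    by (simp add: coeff_sum lookup_sum)
  then obtain i where "i \<in> I" "Poly_Mapping.lookup (coeff (q i $ j) k) u \<noteq> 0"
    by (meson sum.neutral)
  then show "bideg w u + (d j, int k + int (\<epsilon> j)) = b"
    using assms unfolding bihomogeneous_of_iff by blast
qed

lemma bihomogeneous_t_times_cancel:
  fixes q :: "('n::finite, 'k::field) mpoly poly ^ 'm::finite"
  assumes "bihomogeneous_of w d \<epsilon> b (t_times q)"
  shows "bihomogeneous w d \<epsilon> q"
proof -
  have "bihomogeneous_of w d \<epsilon> (b - (0, 1)) q"
    unfolding bihomogeneous_of_iff
  proof (intro allI impI)
    fix j k u assume "Poly_Mapping.lookup (coeff (q $ j) k) u \<noteq> 0"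
    then have "Poly_Mapping.lookup (coeff (t_times q $ j) (Suc k)) u \<noteq> 0"
      by (simp add: coeff_t_times)
    then have "bideg w u + (d j, int (Suc k) + int (\<epsilon> j)) = b"
      using assms unfolding bihomogeneous_of_iff by blast
    then show "bideg w u + (d j, int k + int (\<epsilon> j)) = b - (0, 1)"
      by (auto simp: bideg_def)
  qed
  then show ?thesis unfolding bihomogeneous_def by blast
qed

definition component ::
    "('n::finite \<Rightarrow> nat) \<Rightarrow> int \<times> int \<Rightarrow> ('n, 'k::comm_ring_1) mpoly \<Rightarrow> ('n, 'k) mpoly"
  where "component w b p =
    (\<Sum>u | u \<in> Poly_Mapping.keys p \<and> bideg w u = b. Poly_Mapping.single u (Poly_Mapping.lookup p u))"

lemma lookup_component:
  "Poly_Mapping.lookup (component w b p) u = (if bideg w u = b then Poly_Mapping.lookup p u else 0)"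
  unfolding component_def
  by (auto simp: lookup_sum lookup_single when_def in_keys_iff)

lemma bihomogeneous_component: "bihomogeneous_poly w b (component w b p)"
  by (simp add: bihomogeneous_poly_iff lookup_component)

text \<open>
  Multiplication by a bihomogeneous \<open>x\<close> shifts components: the remaining terms of \<open>p\<close> cannot
  contribute to the bidegree \<open>b + c\<close> of the product.
\<close>

lemma lookup_component_mult:
  fixes p x :: "('n::finite, 'k::comm_ring_1) mpoly"
  assumes x: "bihomogeneous_poly w c x"
  shows "Poly_Mapping.lookup (component w b p * x) m =
    (if bideg w m = b + c then Poly_Mapping.lookup (p * x) m else 0)"
proof (cases "bideg w m = b + c")
  case True
  have "Poly_Mapping.lookup ((p - component w b p) * x) m = 0"
  proof (rule ccontr)
    assume "Poly_Mapping.lookup ((p - component w b p) * x) m \<noteq> 0"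
    then obtain u v where uv: "m = u + v" "Poly_Mapping.lookup (p - component w b p) u \<noteq> 0"
        "Poly_Mapping.lookup x v \<noteq> 0"
      by (rule lookup_mult_nonzero)
    then have "bideg w u \<noteq> b" by (auto simp: lookup_minus lookup_component)
    moreover have "bideg w v = c" using x uv unfolding bihomogeneous_poly_iff by blast
    ultimately show False using True uv by (simp add: bideg_add)
  qed
  then show ?thesis using True by (simp add: left_diff_distrib lookup_minus)
next
  case False
  have "Poly_Mapping.lookup (component w b p * x) m = 0"
  proof (rule ccontr)
    assume "Poly_Mapping.lookup (component w b p * x) m \<noteq> 0"
    then obtain u v where uv: "m = u + v" "Poly_Mapping.lookup (component w b p) u \<noteq> 0"
        "Poly_Mapping.lookup x v \<noteq> 0"
      by (rule lookup_mult_nonzero)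
    then have "bideg w u = b" by (auto simp: lookup_component split: if_splits)
    moreover have "bideg w v = c" using x uv unfolding bihomogeneous_poly_iff by blast
    ultimately show False using False uv by (simp add: bideg_add)
  qed
  then show ?thesis using False by simp
qed

text \<open>
  The \<open>g\<^sub>i(0)\<close> are bihomogeneous of bidegree \<open>b\<^sub>i\<close>, so taking the component of bidegree \<open>c\<close> of a
  relation among them picks the component of bidegree \<open>c - b\<^sub>i\<close> from its \<open>i\<close>-th coefficient.
\<close>

lemma component_syzygy:
  fixes g :: "'i \<Rightarrow> ('n::finite, 'k::field) mpoly poly ^ 'm::finite"
  assumes g: "\<And>i. i \<in> I \<Longrightarrow> bihomogeneous_of w d \<epsilon> (b i) (g i)"
    and v: "(\<Sum>i\<in>I. v i *s eval_t0 (g i)) = 0"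
  shows "(\<Sum>i\<in>I. component w (c - b i) (v i) *s eval_t0 (g i)) = 0"
proof -
  have "Poly_Mapping.lookup ((\<Sum>i\<in>I. component w (c - b i) (v i) *s eval_t0 (g i)) $ j) m = 0" for j m
  proof -
    have summand: "Poly_Mapping.lookup (component w (c - b i) (v i) * (eval_t0 (g i) $ j)) m =
        (if bideg w m + (d j, int (\<epsilon> j)) = c then Poly_Mapping.lookup (v i * (eval_t0 (g i) $ j)) m else 0)"
      if "i \<in> I" for i
    proof -
      have "bihomogeneous_poly w (b i - (d j, int (\<epsilon> j))) (eval_t0 (g i) $ j)"
        unfolding bihomogeneous_poly_iff eq_diff_eq
        using g[OF that, unfolded bihomogeneous_of_iff, rule_format, of j 0]
        by (simp add: eval_t0_def poly_0_coeff_0)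
      moreover have "bideg w m = c - b i + (b i - (d j, int (\<epsilon> j))) \<longleftrightarrow>
          bideg w m + (d j, int (\<epsilon> j)) = c"
        by (auto simp: algebra_simps)
      ultimately show ?thesis by (simp add: lookup_component_mult)
    qed
    have "Poly_Mapping.lookup ((\<Sum>i\<in>I. component w (c - b i) (v i) *s eval_t0 (g i)) $ j) m =
        (\<Sum>i\<in>I. if bideg w m + (d j, int (\<epsilon> j)) = c
          then Poly_Mapping.lookup (v i * (eval_t0 (g i) $ j)) m else 0)"
      by (simp add: lookup_sum summand)
    also have "\<dots> = (if bideg w m + (d j, int (\<epsilon> j)) = c
        then Poly_Mapping.lookup ((\<Sum>i\<in>I. v i *s eval_t0 (g i)) $ j) m else 0)"
      by (simp add: lookup_sum)
    finally show ?thesis by (simp add: v)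
  qed
  then show ?thesis by (auto simp: vec_eq_iff intro!: poly_mapping_eqI)
qed

lemma sum_components:
  fixes p :: "('n::finite, 'k::comm_ring_1) mpoly"
  assumes "finite C" "bideg w ` Poly_Mapping.keys p \<subseteq> (\<lambda>c. c - b) ` C"
  shows "p = (\<Sum>c\<in>C. component w (c - b) p)"
proof (rule poly_mapping_eqI)
  fix u
  have "Poly_Mapping.lookup (\<Sum>c\<in>C. component w (c - b) p) u =
    (\<Sum>c\<in>C. if c = bideg w u + b then Poly_Mapping.lookup p u else 0)"
    unfolding lookup_sum lookup_component by (intro sum.cong) (auto simp: algebra_simps)
  also have "\<dots> = Poly_Mapping.lookup p u"
    using assms by (fastforce simp: in_keys_iff)
  finally show "Poly_Mapping.lookup p u = Poly_Mapping.lookup (\<Sum>c\<in>C. component w (c - b) p) u" ..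
qed

text \<open>
  The columns of \<open>\<Phi>\<close> are the bihomogeneous components of finitely many generators of the syzygy
  module. They generate it because they are syzygies themselves and add up to the generators.
\<close>

lemma bihomogeneous_exact_sequence_exists:
  fixes gs :: "(('n::finite, 'k::field) mpoly poly ^ 'm::finite) list"
  assumes "\<forall>g\<in>set gs. bihomogeneous w d \<epsilon> g"
  shows "\<exists>s \<Phi>. bihomogeneous_exact_sequence w d \<epsilon> gs s \<Phi>"
proof -
  let ?r = "length gs"
  have "\<forall>i. \<exists>b. i < ?r \<longrightarrow> bihomogeneous_of w d \<epsilon> b (gs ! i)"
    using assms unfolding bihomogeneous_def by (metis nth_mem)
  then obtain b where b: "\<And>i. i < ?r \<Longrightarrow> bihomogeneous_of w d \<epsilon> (b i) (gs ! i)" by metis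
  define Z :: "(nat \<Rightarrow> ('n, 'k) mpoly) set"
    where "Z = {v. (\<Sum>i<?r. v i *s eval_t0 (gs ! i)) = 0}"
  have "fun_submodule Z"
    unfolding fun_submodule_def Z_def
    by (auto simp: vmod.scale_left_distrib sum.distrib vmod.scale_scale[symmetric]
        vmod.scale_sum_right[symmetric] simp del: vmod.scale_scale)
  from fun_submodule_fg[OF noetherian_mpoly finite_lessThan[of ?r] this]
  obtain B where B: "finite B" "B \<subseteq> Z"
    and B_gen: "\<forall>f\<in>Z. \<exists>a. \<forall>i\<in>{..<?r}. f i = (\<Sum>v\<in>B. a v * v i)"
    by (elim exE conjE)
  define C where "C v = (\<Union>i<?r. (\<lambda>u. bideg w u + b i) ` Poly_Mapping.keys (v i))"
    for v :: "nat \<Rightarrow> ('n, 'k) mpoly"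
  have finC: "finite (C v)" for v unfolding C_def by simp
  have decomp: "v i = (\<Sum>c\<in>C v. component w (c - b i) (v i))" if "i < ?r" for v i
  proof (rule sum_components[OF finC])
    show "bideg w ` Poly_Mapping.keys (v i) \<subseteq> (\<lambda>c. c - b i) ` C v"
      using that unfolding C_def by (force simp: image_iff)
  qed
  \<comment> \<open>each pair of a generator and a bidegree gives a column; \<open>\<Phi>\<close> needs them in a list\<close>
  obtain ps where ps: "set ps = Sigma B C" "distinct ps"
    using finite_distinct_list[of "Sigma B C"] B finC by auto
  define s where "s = length ps"
  define \<Phi> where "\<Phi> i l = component w (snd (ps ! l) - b i) (fst (ps ! l) i)" for i l
  have columns: "(\<Sum>i<?r. \<Phi> i l *s eval_t0 (gs ! i)) = 0" if "l < s" for l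
  proof -
    have "fst (ps ! l) \<in> Z"
      using that B ps(1) nth_mem[of l ps] unfolding s_def by auto
    then show ?thesis
      unfolding \<Phi>_def Z_def using b by (intro component_syzygy) auto
  qed
  have "exact_sequence gs s \<Phi>"
    unfolding exact_sequence_def
  proof (intro allI iffI)
    fix v assume "(\<Sum>i<?r. v i *s eval_t0 (gs ! i)) = 0"
    then have "v \<in> Z" unfolding Z_def by simp
    then obtain a where a: "\<forall>i\<in>{..<?r}. v i = (\<Sum>x\<in>B. a x * x i)"
      using bspec[OF B_gen] by meson
    have "v i = (\<Sum>l<s. \<Phi> i l * a (fst (ps ! l)))" if i: "i < ?r" for i
    proof -
      have "v i = (\<Sum>x\<in>B. a x * x i)" using a i by blast
      also have "\<dots> = (\<Sum>x\<in>B. \<Sum>c\<in>C x. component w (c - b i) (x i) * a x)"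
        by (subst decomp[OF i]) (simp add: sum_distrib_left mult.commute)
      also have "\<dots> = (\<Sum>(x, c)\<in>set ps. component w (c - b i) (x i) * a x)"
        unfolding ps using B finC by (intro sum.Sigma) auto
      also have "\<dots> = (\<Sum>l<s. case ps ! l of (x, c) \<Rightarrow> component w (c - b i) (x i) * a x)"
        by (rule sum.reindex_bij_betw[OF bij_betw_nth, symmetric]) (auto simp: s_def ps)
      finally show ?thesis unfolding \<Phi>_def by (simp add: case_prod_beta)
    qed
    then show "\<exists>x. \<forall>i<?r. v i = (\<Sum>l<s. \<Phi> i l * x l)"
      by (intro exI[of _ "\<lambda>l. a (fst (ps ! l))"]) blast
  next
    fix v assume "\<exists>x. \<forall>i<?r. v i = (\<Sum>l<s. \<Phi> i l * x l)"
    then obtain x where "\<forall>i<?r. v i = (\<Sum>l<s. \<Phi> i l * x l)" by blast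
    then have "(\<Sum>i<?r. v i *s eval_t0 (gs ! i)) =
        (\<Sum>i<?r. \<Sum>l<s. x l *s (\<Phi> i l *s eval_t0 (gs ! i)))"
      by (simp add: vmod.scale_sum_left mult.commute)
    also have "\<dots> = (\<Sum>l<s. x l *s (\<Sum>i<?r. \<Phi> i l *s eval_t0 (gs ! i)))"
      by (subst sum.swap) (simp add: vmod.scale_sum_right)
    also have "\<dots> = 0" by (simp add: columns)
    finally show "(\<Sum>i<?r. v i *s eval_t0 (gs ! i)) = 0" .
  qed
  moreover have "bihomogeneous_poly w
      (fst (snd (ps ! l)) - fst (b i), snd (snd (ps ! l)) - snd (b i)) (\<Phi> i l)" for i l
    using bihomogeneous_component[of w "snd (ps ! l) - b i"]
    unfolding \<Phi>_def by (simp add: minus_prod_def)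
  ultimately show ?thesis
    unfolding bihomogeneous_exact_sequence_def using b
    by (intro exI[of _ s] exI[of _ \<Phi>] conjI exI[of _ b] exI[of _ "\<lambda>l. snd (ps ! l)"]) auto
qed

section \<open>One round of the procedure\<close>

lemma span_set_obtains:
  fixes gs :: "('a::comm_ring_1 ^ 'm) list"
  assumes "x \<in> submodule_span (set gs)"
  obtains a where "x = (\<Sum>i<length gs. a i *s (gs ! i))"
proof -
  have "\<exists>a. x = (\<Sum>i<length gs. a i *s (gs ! i))"
    using assms
  proof (induction rule: vmod.span_induct_alt)
    case base
    then show ?case by (intro exI[of _ "\<lambda>_. 0"]) simp
  next
    case (step c x y)
    then obtain a i where i: "i < length gs" "x = gs ! i" "y = (\<Sum>i<length gs. a i *s (gs ! i))"
      by (auto simp: in_set_conv_nth)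
    have "(\<Sum>l<length gs. (a l + (if l = i then c else 0)) *s (gs ! l)) =
        (\<Sum>l<length gs. a l *s (gs ! l) + (if l = i then c *s (gs ! l) else 0))"
      by (intro sum.cong) (auto simp: vmod.scale_left_distrib)
    also have "\<dots> = c *s x + y" using i by (simp add: sum.distrib)
    finally show ?case by (intro exI) (rule sym)
  qed
  then show ?thesis using that by blast
qed

lemma sum_in_span_set:
  fixes gs :: "('a::comm_ring_1 ^ 'm) list"
  shows "(\<Sum>i<length gs. a i *s (gs ! i)) \<in> submodule_span (set gs)"
  by (intro vmod.span_sum vmod.span_scale vmod.span_base) simp

lemma syzygy_image_subset: "syzygy_image gs s \<Phi> \<subseteq> submodule_span (set gs)"
  unfolding syzygy_image_def by (auto intro: sum_in_span_set)

lemma syzygy_image_columns: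
  fixes gs :: "(('n, 'k::field) mpoly poly ^ 'm::finite) list"
  shows "syzygy_image gs s \<Phi> =
    {\<Sum>l<s. y l *s (\<Sum>i<length gs. [:\<Phi> i l:] *s (gs ! i)) | y. True}"
proof -
  have "(\<Sum>i<length gs. (\<Sum>l<s. [:\<Phi> i l:] * y l) *s (gs ! i)) =
      (\<Sum>l<s. y l *s (\<Sum>i<length gs. [:\<Phi> i l:] *s (gs ! i)))" for y
  proof -
    have "(\<Sum>i<length gs. (\<Sum>l<s. [:\<Phi> i l:] * y l) *s (gs ! i)) =
        (\<Sum>i<length gs. \<Sum>l<s. y l *s ([:\<Phi> i l:] *s (gs ! i)))"
      by (simp add: vmod.scale_sum_left mult.commute)
    also have "\<dots> = (\<Sum>l<s. y l *s (\<Sum>i<length gs. [:\<Phi> i l:] *s (gs ! i)))"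
      by (subst sum.swap) (simp add: vmod.scale_sum_right)
    finally show ?thesis .
  qed
  then show ?thesis unfolding syzygy_image_def by simp
qed

text \<open>
  The columns of \<open>\<Phi>\<close> are syzygies of the \<open>g\<^sub>i(0)\<close>, so the corresponding combinations \<open>h\<^sub>l\<close> of the
  \<open>g\<^sub>i\<close> vanish at \<open>t = 0\<close>. Dividing them by \<open>t\<close> gives the generators sought, of the bidegree of the
  column lowered by \<open>(0, 1)\<close>.
\<close>

lemma round_quotient_generators:
  fixes gs :: "(('n::finite, 'k::field) mpoly poly ^ 'm::finite) list"
  assumes "bihomogeneous_exact_sequence w d \<epsilon> gs s \<Phi>"
  obtains qs where "\<forall>q\<in>set qs. bihomogeneous w d \<epsilon> q"
    "syzygy_image gs s \<Phi> = t_times ` submodule_span (set qs)"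
proof -
  let ?r = "length gs"
  obtain b c where exact: "exact_sequence gs s \<Phi>"
    and b: "\<And>i. i < ?r \<Longrightarrow> bihomogeneous_of w d \<epsilon> (b i) (gs ! i)"
    and c: "\<And>i l. i < ?r \<Longrightarrow> l < s \<Longrightarrow>
      bihomogeneous_poly w (fst (c l) - fst (b i), snd (c l) - snd (b i)) (\<Phi> i l)"
    using assms unfolding bihomogeneous_exact_sequence_def by blast
  define h where "h l = (\<Sum>i<?r. [:\<Phi> i l:] *s (gs ! i))" for l
  have h_bihom: "bihomogeneous_of w d \<epsilon> (c l) (h l)" if "l < s" for l
    unfolding h_def
  proof (rule bihomogeneous_of_sum)
    fix i assume "i \<in> {..<?r}"
    then have "bihomogeneous_of w d \<epsilon> ((fst (c l) - fst (b i), snd (c l) - snd (b i)) + b i)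
        ([:\<Phi> i l:] *s (gs ! i))"
      using b c that by (intro bihomogeneous_of_scale) auto
    then show "bihomogeneous_of w d \<epsilon> (c l) ([:\<Phi> i l:] *s (gs ! i))"
      by (simp add: plus_prod_def)
  qed
  have "\<exists>q. h l = t_times q" if "l < s" for l
  proof -
    have "(\<Sum>k<s. \<Phi> i k * (if k = l then 1 else 0)) = \<Phi> i l" for i
      using that by (simp add: if_distrib[of "\<lambda>x. _ * x"] cong: if_cong)
    \<comment> \<open>exactness at the \<open>l\<close>-th basis vector\<close>
    then have "\<exists>x. \<forall>i<?r. \<Phi> i l = (\<Sum>k<s. \<Phi> i k * x k)"
      by (intro exI[of _ "\<lambda>k. if k = l then 1 else 0"]) simp
    then have "(\<Sum>i<?r. \<Phi> i l *s eval_t0 (gs ! i)) = 0"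
      by (rule exact[unfolded exact_sequence_def, THEN spec, THEN iffD2])
    then have "eval_t0 (h l) = 0"
      unfolding h_def eval_t0_eq by (simp add: eval_t_sum eval_t_scale)
    then obtain q where "h l = t_times q" by (rule eval_t0_zero_obtains)
    then show ?thesis by blast
  qed
  then obtain q where q: "\<And>l. l < s \<Longrightarrow> h l = t_times (q l)" by metis
  let ?qs = "map q [0..<s]"
  have "bihomogeneous w d \<epsilon> p" if "p \<in> set ?qs" for p
  proof -
    obtain l where "l < s" "p = q l" using \<open>p \<in> set ?qs\<close> by auto
    then have "bihomogeneous_of w d \<epsilon> (c l) (t_times p)" using h_bihom[of l] q[of l] by simp
    then show ?thesis by (rule bihomogeneous_t_times_cancel)
  qed
  moreover have "syzygy_image gs s \<Phi> = t_times ` submodule_span (set ?qs)"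
  proof -
    have comb: "(\<Sum>l<s. y l *s h l) = t_times (\<Sum>l<length ?qs. y l *s (?qs ! l))" for y
      by (simp add: t_times_sum t_times_scale q)
    show ?thesis
    proof (intro equalityI subsetI)
      fix x assume "x \<in> syzygy_image gs s \<Phi>"
      then obtain y where "x = (\<Sum>l<s. y l *s h l)"
        unfolding syzygy_image_columns h_def by blast
      then show "x \<in> t_times ` submodule_span (set ?qs)"
        unfolding comb using sum_in_span_set[where gs = ?qs and a = y] by blast
    next
      fix x assume "x \<in> t_times ` submodule_span (set ?qs)"
      then obtain z where z: "x = t_times z" "z \<in> submodule_span (set ?qs)" by blast
      obtain y where "z = (\<Sum>l<length ?qs. y l *s (?qs ! l))"
        by (rule span_set_obtains[OF z(2)])
      then have "x = (\<Sum>l<s. y l *s h l)" unfolding comb z(1) by simp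
      then show "x \<in> syzygy_image gs s \<Phi>"
        unfolding syzygy_image_columns h_def by blast
    qed
  qed
  ultimately show ?thesis by (intro that[of ?qs]) blast+
qed

lemma round_quotient_unique:
  assumes "round_quotient w d \<epsilon> gs s \<Phi> Q" "round_quotient w d \<epsilon> gs s \<Phi> Q'"
  shows "Q = Q'"
proof -
  have "t_times ` Q = t_times ` Q'" using assms unfolding round_quotient_def by simp
  moreover have "inj t_times" by (simp add: inj_def t_times_eq_iff)
  ultimately show ?thesis using inj_image_eq_iff by blast
qed

lemma round_quotient_ex1:
  assumes "bihomogeneous_exact_sequence w d \<epsilon> gs s \<Phi>"
  shows "\<exists>!Q. round_quotient w d \<epsilon> gs s \<Phi> Q"
proof -
  obtain qs where "\<forall>q\<in>set qs. bihomogeneous w d \<epsilon> q"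
      "syzygy_image gs s \<Phi> = t_times ` submodule_span (set qs)"
    using round_quotient_generators[OF assms] by blast
  then have "round_quotient w d \<epsilon> gs s \<Phi> (submodule_span (set qs))"
    unfolding round_quotient_def bihomogeneous_submodule_def by blast
  then show ?thesis using round_quotient_unique by blast
qed

lemma enlarged_gens_exists:
  assumes gs: "\<forall>g\<in>set gs. bihomogeneous w d \<epsilon> g"
    and exact: "bihomogeneous_exact_sequence w d \<epsilon> gs s \<Phi>"
    and Q: "round_quotient w d \<epsilon> gs s \<Phi> Q"
  shows "\<exists>gs'. enlarged_gens w d \<epsilon> gs Q gs'"
proof -
  obtain qs where qs: "\<forall>q\<in>set qs. bihomogeneous w d \<epsilon> q"
      "syzygy_image gs s \<Phi> = t_times ` submodule_span (set qs)"
    using round_quotient_generators[OF exact] by blast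
  then have "round_quotient w d \<epsilon> gs s \<Phi> (submodule_span (set qs))"
    unfolding round_quotient_def bihomogeneous_submodule_def by blast
  with Q have "Q = submodule_span (set qs)" by (rule round_quotient_unique)
  then have "enlarged_gens w d \<epsilon> gs Q (gs @ qs)"
    using gs qs(1) unfolding enlarged_gens_def by (auto simp: vmod.span_Un)
  then show ?thesis by blast
qed

text \<open>
  A generator \<open>q\<close> of \<open>Q\<close> and \<open>t q\<close> have the same value at \<open>t = 1\<close>, and \<open>t q\<close> lies in \<open>M~\<close>.
\<close>

lemma round_quotient_subset_homogenized_module:
  assumes Q: "round_quotient w d \<epsilon> gs s \<Phi> Q"
    and gs: "submodule_span (set gs) \<subseteq> homogenized_module w \<epsilon> M"
    and M: "submodule_span M = M"
  shows "Q \<subseteq> homogenized_module w \<epsilon> M"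
proof -
  obtain B where B: "\<forall>q\<in>B. bihomogeneous w d \<epsilon> q" "Q = submodule_span B"
    using Q unfolding round_quotient_def bihomogeneous_submodule_def by blast
  have "q \<in> homogenized_module w \<epsilon> M" if q: "q \<in> B" for q
  proof -
    have "q \<in> Q" using q B vmod.span_base by blast
    then have "t_times q \<in> syzygy_image gs s \<Phi>"
      using Q unfolding round_quotient_def by simp
    then have "t_times q \<in> homogenized_module w \<epsilon> M"
      using syzygy_image_subset[of gs s \<Phi>] gs by (meson subsetD)
    then have "eval_t 1 q \<in> M"
      using eval_t1_homogenized_module[of "t_times q" w \<epsilon> M] M by (simp add: eval_t1_t_times)
    obtain e where "weight_homogeneous w \<epsilon> e q"
      by (rule bihomogeneous_imp_weight_homogeneous[OF B(1)[rule_format, OF q]])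
    then show ?thesis
      using \<open>eval_t 1 q \<in> M\<close> by (rule weight_homogeneous_in_homogenized_module)
  qed
  then have "B \<subseteq> homogenized_module w \<epsilon> M" by blast
  then show ?thesis
    unfolding B(2) homogenized_module_def by (intro vmod.span_minimal vmod.subspace_span)
qed

text \<open>
  This is the reason for the stopping criterion: syzygies modulo \<open>t\<close> are the only obstruction to
  dividing by \<open>t\<close> inside the module, and the criterion says that they create nothing new.
\<close>

lemma stops_t_saturated:
  fixes gs :: "(('n::finite, 'k::field) mpoly poly ^ 'm::finite) list"
  assumes stops: "stops w d \<epsilon> gs" and q: "t_times q \<in> submodule_span (set gs)"
  shows "q \<in> submodule_span (set gs)"
proof -
  let ?r = "length gs"
  obtain s \<Phi> Q where exact: "exact_sequence gs s \<Phi>" and Q: "syzygy_image gs s \<Phi> = t_times ` Q"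
      "Q \<subseteq> submodule_span (set gs)"
    using stops unfolding stops_def bihomogeneous_exact_sequence_def round_quotient_def
    by (elim exE conjE)
  obtain a where a: "t_times q = (\<Sum>i<?r. a i *s (gs ! i))"
    by (rule span_set_obtains[OF q])
  have "\<exists>a'. a i = pCons (poly (a i) 0) a'" for i
    by (cases "a i") simp
  then obtain a' where a': "\<And>i. a i = pCons (poly (a i) 0) (a' i)" by metis
  have "eval_t 0 (t_times q) = 0" by (simp add: t_times_def eval_t_def vec_eq_iff)
  then have "(\<Sum>i<?r. poly (a i) 0 *s eval_t0 (gs ! i)) = 0"
    unfolding a by (simp add: eval_t_sum eval_t_scale eval_t0_eq)
  then obtain x where x: "\<And>i. i < ?r \<Longrightarrow> poly (a i) 0 = (\<Sum>l<s. \<Phi> i l * x l)"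
    using exact unfolding exact_sequence_def by meson
  have const_sum: "(\<Sum>l<s. [:\<Phi> i l:] * [:x l:]) = [:\<Sum>l<s. \<Phi> i l * x l:]" for i
    by (induction s) (simp_all add: mult.commute)
  have "(\<Sum>i<?r. [:poly (a i) 0:] *s (gs ! i)) =
      (\<Sum>i<?r. (\<Sum>l<s. [:\<Phi> i l:] * [:x l:]) *s (gs ! i))"
    by (rule sum.cong[OF refl]) (simp only: const_sum x lessThan_iff)
  also have "\<dots> \<in> syzygy_image gs s \<Phi>"
    unfolding syzygy_image_def by (rule CollectI, rule exI, rule conjI[OF refl TrueI])
  finally obtain z where z: "(\<Sum>i<?r. [:poly (a i) 0:] *s (gs ! i)) = t_times z" "z \<in> Q"
    unfolding Q by blast
  \<comment> \<open>separates the constant term of \<open>a\<^sub>i\<close> from its multiple of \<open>t\<close>\<close>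
  have split: "a i *s x = [:poly (a i) 0:] *s x + t_times (a' i *s x)" for i x
  proof -
    have "a i = [:poly (a i) 0:] + [:0, 1:] * a' i" by (subst a') simp
    then have "a i *s x = ([:poly (a i) 0:] + [:0, 1:] * a' i) *s x" by (rule arg_cong)
    then show ?thesis
      unfolding t_times_def vmod.scale_left_distrib vmod.scale_scale .
  qed
  have "t_times q = (\<Sum>i<?r. [:poly (a i) 0:] *s (gs ! i)) + (\<Sum>i<?r. t_times (a' i *s (gs ! i)))"
    unfolding a sum.distrib[symmetric] by (rule sum.cong[OF refl]) (rule split)
  also have "\<dots> = t_times (z + (\<Sum>i<?r. a' i *s (gs ! i)))"
    by (simp add: z t_times_add t_times_sum)
  finally have "q = z + (\<Sum>i<?r. a' i *s (gs ! i))" by (simp add: t_times_eq_iff)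
  then show ?thesis
    using z(2) Q(2) sum_in_span_set[of a' gs] by (auto intro: vmod.span_add)
qed

text \<open>
  A power of \<open>t\<close> times the homogenization of \<open>f\<close> lies in the module by lifting \<open>f\<close>; saturation
  removes the power.
\<close>

lemma stops_contains_homogenized_module:
  fixes gs :: "(('n::finite, 'k::field) mpoly poly ^ 'm::finite) list"
  assumes stops: "stops w d \<epsilon> gs"
    and gens: "homogenization w \<epsilon> ` F \<subseteq> submodule_span (set gs)"
  shows "homogenized_module w \<epsilon> (submodule_span F) \<subseteq> submodule_span (set gs)"
proof -
  let ?N = "submodule_span (set gs)"
  have "homogenization w \<epsilon> f \<in> ?N" if f: "f \<in> submodule_span F" for f
  proof -
    obtain e q where q: "weight_homogeneous w \<epsilon> e q" "q \<in> ?N" "eval_t 1 q = f"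
    proof (rule weight_homogeneous_lift[of ?N F w \<epsilon> f])
      show "homogenization w \<epsilon> g \<in> ?N" if "g \<in> F" for g using gens that by blast
    qed (use f in \<open>auto intro: vmod.span_add vmod.span_scale vmod.span_zero\<close>)
    obtain n where "q = monom 1 n *s homogenization w \<epsilon> f"
      by (rule weight_homogeneous_eq_homogenization[OF q(1), unfolded q(3)])
    with q(2) have "monom 1 n *s homogenization w \<epsilon> f \<in> ?N" by simp
    then show ?thesis
    proof (induction n)
      case 0
      then show ?case by (simp add: one_pCons[symmetric] monom_0)
    next
      case (Suc n)
      have "monom 1 (Suc n) *s homogenization w \<epsilon> f = t_times (monom 1 n *s homogenization w \<epsilon> f)"
        by (simp add: t_times_def monom_Suc)
      then have "t_times (monom 1 n *s homogenization w \<epsilon> f) \<in> ?N" using Suc.prems by simp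
      then show ?case by (rule Suc.IH[OF stops_t_saturated[OF stops]])
    qed
  qed
  then show ?thesis
    unfolding homogenized_module_def by (intro vmod.span_minimal vmod.subspace_span) blast
qed

lemma bihomogeneous_homogenization:
  assumes "homogeneous d f"
  shows "bihomogeneous w d \<epsilon> (homogenization w \<epsilon> f)"
proof -
  obtain a where a: "\<And>u j. Poly_Mapping.lookup (f $ j) u \<noteq> 0 \<Longrightarrow> int (tdeg u) + d j = a"
    using assms unfolding homogeneous_def monomials_def by (auto simp: in_keys_iff)
  have "bihomogeneous_of w d \<epsilon> (a, int (max_weight w \<epsilon> f)) (homogenization w \<epsilon> f)"
    unfolding bihomogeneous_of_iff by (auto simp: lookup_homogenization bideg_def a split: if_splits)
  then show ?thesis unfolding bihomogeneous_def by blast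
qed

lemma continues_chain:
  assumes "(continues w d \<epsilon>)\<^sup>*\<^sup>* gs0 gs"
    and "\<forall>g\<in>set gs0. bihomogeneous w d \<epsilon> g"
    and "submodule_span (set gs0) \<subseteq> homogenized_module w \<epsilon> M" "submodule_span M = M"
  shows "(\<forall>g\<in>set gs. bihomogeneous w d \<epsilon> g) \<and>
    submodule_span (set gs0) \<subseteq> submodule_span (set gs) \<and>
    submodule_span (set gs) \<subseteq> homogenized_module w \<epsilon> M"
  using assms(1)
proof induction
  case base
  then show ?case using assms by simp
next
  case (step gs gs')
  then obtain s \<Phi> Q where Q: "round_quotient w d \<epsilon> gs s \<Phi> Q" "enlarged_gens w d \<epsilon> gs Q gs'"
    unfolding continues_def by blast
  then have sum: "submodule_span (set gs') = {x + y | x y. x \<in> submodule_span (set gs) \<and> y \<in> Q}"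
    unfolding enlarged_gens_def by blast
  have "Q \<subseteq> homogenized_module w \<epsilon> M"
    using Q step assms by (intro round_quotient_subset_homogenized_module[OF Q(1)]) auto
  then have "submodule_span (set gs') \<subseteq> homogenized_module w \<epsilon> M"
    using step unfolding sum homogenized_module_def by (auto intro!: vmod.span_add)
  moreover have "0 \<in> Q"
    using Q(1) vmod.span_zero unfolding round_quotient_def bihomogeneous_submodule_def by blast
  then have "submodule_span (set gs) \<subseteq> submodule_span (set gs')"
    unfolding sum by force
  ultimately show ?case using step Q(2) unfolding enlarged_gens_def by blast
qed

lemma continues_increases:
  assumes "continues w d \<epsilon> gs gs'"
  shows "submodule_span (set gs) \<subset> submodule_span (set gs')"
proof -
  obtain s \<Phi> Q where Q: "round_quotient w d \<epsilon> gs s \<Phi> Q" "\<not> Q \<subseteq> submodule_span (set gs)"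
      and sum: "submodule_span (set gs') = {x + y | x y. x \<in> submodule_span (set gs) \<and> y \<in> Q}"
    using assms unfolding continues_def enlarged_gens_def by blast
  have "0 \<in> Q"
    using Q(1) vmod.span_zero unfolding round_quotient_def bihomogeneous_submodule_def by blast
  then have "submodule_span (set gs) \<subseteq> submodule_span (set gs')" unfolding sum by force
  moreover have "Q \<subseteq> submodule_span (set gs')"
    unfolding sum using vmod.span_zero[of "set gs"] by force
  ultimately show ?thesis using Q(2) by blast
qed

theorem mainTheorem5:
  fixes w :: "'n::finite \<Rightarrow> nat"
    and d :: "'m::finite \<Rightarrow> int"
    and \<epsilon> :: "'m \<Rightarrow> nat"
    and fs :: "(('n, 'k::field) mpoly ^ 'm) list"
    and M :: "(('n, 'k) mpoly ^ 'm) set"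
    and gs0 :: "(('n, 'k) mpoly poly ^ 'm) list"
  assumes "\<forall>f\<in>set fs. homogeneous d f"
    and "M = submodule_span (set fs)"
    and "gs0 = map (homogenization w \<epsilon>) fs"
  shows
    \<comment> \<open>every round can be carried out, whatever choices were made before\<close>
    "(\<forall>gs. (continues w d \<epsilon>)\<^sup>*\<^sup>* gs0 gs \<longrightarrow>
       (\<forall>g\<in>set gs. bihomogeneous w d \<epsilon> g) \<and>
       (\<exists>s \<Phi>. bihomogeneous_exact_sequence w d \<epsilon> gs s \<Phi>) \<and>
       (\<forall>s \<Phi>. bihomogeneous_exact_sequence w d \<epsilon> gs s \<Phi> \<longrightarrow>
          (\<exists>!Q. round_quotient w d \<epsilon> gs s \<Phi> Q) \<and>
          (\<forall>Q. round_quotient w d \<epsilon> gs s \<Phi> Q \<longrightarrow>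
             Q \<subseteq> submodule_span (set gs) \<or> (\<exists>gs'. enlarged_gens w d \<epsilon> gs Q gs')))) \<and>
     (\<not> (\<exists>G. G 0 = gs0 \<and> (\<forall>k. continues w d \<epsilon> (G k) (G (Suc k))))) \<and>
     (\<forall>gs. (continues w d \<epsilon>)\<^sup>*\<^sup>* gs0 gs \<and> stops w d \<epsilon> gs \<longrightarrow>
       submodule_span (set gs) = homogenized_module w \<epsilon> M \<and>
       eval_t0 ` submodule_span (set gs) = initial_module w \<epsilon> M)"
proof -
  have M: "submodule_span M = M" using assms(2) by (simp add: vmod.span_span)
  have gs0_bihom: "\<forall>g\<in>set gs0. bihomogeneous w d \<epsilon> g"
    using assms(1,3) by (auto intro: bihomogeneous_homogenization)
  have gs0_sub: "submodule_span (set gs0) \<subseteq> homogenized_module w \<epsilon> M"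
  proof -
    have "f \<in> M" if "f \<in> set fs" for f
      using that assms(2) by (simp add: vmod.span_base)
    then have "set gs0 \<subseteq> homogenized_module w \<epsilon> M"
      using assms(3) by (auto intro: homogenization_in_homogenized_module)
    then show ?thesis
      unfolding homogenized_module_def by (rule vmod.span_minimal) (rule vmod.subspace_span)
  qed
  note chain = continues_chain[OF _ gs0_bihom gs0_sub M]
  have rounds: "(\<forall>g\<in>set gs. bihomogeneous w d \<epsilon> g) \<and>
       (\<exists>s \<Phi>. bihomogeneous_exact_sequence w d \<epsilon> gs s \<Phi>) \<and>
       (\<forall>s \<Phi>. bihomogeneous_exact_sequence w d \<epsilon> gs s \<Phi> \<longrightarrow>
          (\<exists>!Q. round_quotient w d \<epsilon> gs s \<Phi> Q) \<and>
          (\<forall>Q. round_quotient w d \<epsilon> gs s \<Phi> Q \<longrightarrow>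
             Q \<subseteq> submodule_span (set gs) \<or> (\<exists>gs'. enlarged_gens w d \<epsilon> gs Q gs')))"
    if "(continues w d \<epsilon>)\<^sup>*\<^sup>* gs0 gs" for gs
  proof -
    have gs: "\<forall>g\<in>set gs. bihomogeneous w d \<epsilon> g" using chain[OF that] by blast
    show ?thesis
      by (intro conjI allI impI disjI2 gs bihomogeneous_exact_sequence_exists[OF gs]
          round_quotient_ex1 enlarged_gens_exists[OF gs])
  qed
  have terminates: "\<not> (\<exists>G. G 0 = gs0 \<and> (\<forall>k. continues w d \<epsilon> (G k) (G (Suc k))))"
  proof
    assume "\<exists>G. G 0 = gs0 \<and> (\<forall>k. continues w d \<epsilon> (G k) (G (Suc k)))"
    then obtain G where "G 0 = gs0" and G: "\<And>k. continues w d \<epsilon> (G k) (G (Suc k))" by blast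
    from G have "submodule_span (set (G k)) \<subset> submodule_span (set (G (Suc k)))" for k
      by (rule continues_increases)
    then show False by (rule no_increasing_spans[OF noetherian_mpoly_poly])
  qed
  have result: "submodule_span (set gs) = homogenized_module w \<epsilon> M \<and>
       eval_t0 ` submodule_span (set gs) = initial_module w \<epsilon> M"
    if "(continues w d \<epsilon>)\<^sup>*\<^sup>* gs0 gs" "stops w d \<epsilon> gs" for gs
  proof -
    have "homogenization w \<epsilon> ` set fs \<subseteq> submodule_span (set gs)"
      using chain[OF that(1)] assms(3) vmod.span_superset[of "set gs0"] by auto
    then have "homogenized_module w \<epsilon> M \<subseteq> submodule_span (set gs)"
      unfolding assms(2) by (rule stops_contains_homogenized_module[OF that(2)])
    then have "submodule_span (set gs) = homogenized_module w \<epsilon> M"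
      using chain[OF that(1)] by blast
    then show ?thesis by (simp add: eval_t0_homogenized_module)
  qed
  show ?thesis
    by (rule conjI, intro allI impI, erule rounds, rule conjI[OF terminates],
        intro allI impI, erule conjE, erule (1) result)
qed

end
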